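(* Let $\Omega$ be a bounded domain in $\mathbb{R}^n$. Let $\sigma>0$, $0<p<\infty$, $0<q\le\infty$, and let $\Gamma=\partial\Omega$ be an $h$-set with $$\sup_{j\in\mathbb{N}_0}\sum_{k=0}^\infty2^{k\sigma q}\left(\frac{h(2^{-j})}{h(2^{-j-k})}2^{-kn}\right)^{q/p}<\infty$$ (with the usual modification if $q=\infty$, i.e. $\sup_{j,k\in\mathbb{N}_0}2^{k\sigma}\big(\frac{h(2^{-j})}{h(2^{-j-k})}2^{-kn}\big)^{1/p}<\infty$). Then the characteristic function $\chi_\Omega$ of $\Omega$ satisfies $$\chi_\Omega\in\mathbf{B}^\sigma_{p,q,\mathrm{selfs}}(\mathbb{R}^n).$$
   Context: $h$-sets: let $\Gamma\subset\mathbb{R}^n$ be non-empty and compact and let $h$ be a positive non-decreasing function on $(0,1]$. $\Gamma$ is an $h$-set if there is a finite Radon measure $\mu$ in $\mathbb{R}^n$ with $\operatorname{supp}\mu=\Gamma$ and $\mu(B(\gamma,r))\sim h(r)$ for all $\gamma\in\Gamma$, $0<r\le1$ (two-sided estimate with positive constants independent of $\gamma,r$), $B(\gamma,r)$ being the open ball. Besov spaces: for $j\in\mathbb{N}_0$, $m\in\mathbb{Z}^n$, let $Q_{j,m}$ be the axis-parallel cube with centre $2^{-j}m$ and side length $2^{-j+1}$, $dQ_{j,m}$ the concentric cube with side length $d$ times as large. For complex $\lambda=\{\lambda_{j,m}\}$, $\|\lambda|b^s_{p,q}\|=\big(\sum_{j=0}^\infty2^{j(s-n/p)q}(\sum_{m\in\mathbb{Z}^n}|\lambda_{j,m}|^p)^{q/p}\big)^{1/q}$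 (usual modification for $\infty$). Fix $d>1$ and $K\in\mathbb{N}_0$ with $K\ge1+[s]$; a $K$-atom located at $Q_{j,m}$ is a $C^K$ function $a:\mathbb{R}^n\to\mathbb{C}$ with $\operatorname{supp}a\subset dQ_{j,m}$ and $|D^\alpha a|\le2^{|\alpha|j}$ for $|\alpha|\le K$. $\mathbf{B}^s_{p,q}(\mathbb{R}^n)$, $s>0$, $0<p,q\le\infty$, is the set of $f\in L_p(\mathbb{R}^n)$ with $f=\sum_{j,m}\lambda_{j,m}a_{j,m}$ (convergence in $L_p$), $a_{j,m}$ $K$-atoms located at $Q_{j,m}$, $\|\lambda|b^s_{p,q}\|<\infty$; the quasi-norm is the infimum of $\|\lambda|b^s_{p,q}\|$ over all such representations (independent of $d,K$ up to equivalence). Self-similar spaces: fix a non-negative $C^\infty$ function $\psi$ with $\operatorname{supp}\psi\subset\{y\in\mathbb{R}^n:|y|\le\sqrt n\}$ and $\sum_{l\in\mathbb{Z}^n}\psi(x-l)=1$ for $x\in\mathbb{R}^n$. For $s>0$, $0<p,q\le\infty$, $\mathbf{B}^s_{p,q,\mathrm{selfs}}(\mathbb{R}^n)$ is the set of all $f\in L^{loc}_{\min(1,p)}(\mathbb{R}^n)$ with $\sup_{j\in\mathbb{N}_0,\,l\in\mathbb{Z}^n}\|\psi(\cdot-l)f(2^{-j}\cdot)|\mathbf{B}^s_{p,q}(\mathbb{R}^n)\|<\infty$. *)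

theory Defs
  imports "HOL-Analysis.Analysis" "HOL-Probability.Essential_Supremum"
begin

text \<open>
  Integrability indices p, q range over ]0, \<infinity>] and have type \<^typ>\<open>ennreal\<close>. The term
  enn2real (1 / p) is the real number 1/p, and it is 0 for p = \<infinity>.
\<close>


subsection \<open>h-sets\<close>

definition measure_support :: "'a::topological_space measure \<Rightarrow> 'a set" where
  "measure_support \<mu> = {x. \<forall>U. open U \<and> x \<in> U \<longrightarrow> emeasure \<mu> U > 0}"

text \<open>On \<open>\<real>\<^sup>n\<close> the finite Radon measures are exactly the finite Borel measures.\<close>

definition h_set :: "(real \<Rightarrow> real) \<Rightarrow> (real ^ 'n) set \<Rightarrow> bool" where
  "h_set h \<Gamma> \<longleftrightarrow>
     \<Gamma> \<noteq> {} \<and> compact \<Gamma> \<and>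
     (\<forall>r\<in>{0<..1}. h r > 0) \<and> mono_on {0<..1} h \<and>
     (\<exists>\<mu> :: (real ^ 'n) measure.
        sets \<mu> = sets borel \<and> finite_measure \<mu> \<and> measure_support \<mu> = \<Gamma> \<and>
        (\<exists>c1>0. \<exists>c2>0. \<forall>\<gamma>\<in>\<Gamma>. \<forall>r\<in>{0<..1}.
           c1 * h r \<le> measure \<mu> (ball \<gamma> r) \<and> measure \<mu> (ball \<gamma> r) \<le> c2 * h r))"


subsection \<open>Quasi-norms of sequences and functions\<close>

text \<open>Powers of extended non-negative reals; only exponents r > 0 are used.\<close>

definition epowr :: "ennreal \<Rightarrow> real \<Rightarrow> ennreal" where
  "epowr x r = (if x = \<infinity> then \<infinity> else ennreal (enn2real x powr r))"

definition seq_qnorm :: "ennreal \<Rightarrow> ('i \<Rightarrow> ennreal) \<Rightarrow> ennreal" where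
  "seq_qnorm p u =
     (if p = \<infinity> then (SUP i. u i)
      else epowr (\<Sum>\<^sub>\<infinity>i. epowr (u i) (enn2real p)) (1 / enn2real p))"

definition Lp_qnorm :: "ennreal \<Rightarrow> (real ^ 'n \<Rightarrow> complex) \<Rightarrow> ennreal" where
  "Lp_qnorm p f =
     (if p = \<infinity> then esssup lebesgue (\<lambda>x. ennreal (cmod (f x)))
      else epowr (\<integral>\<^sup>+x. ennreal (cmod (f x) powr enn2real p) \<partial>lebesgue) (1 / enn2real p))"

definition Lp_space :: "ennreal \<Rightarrow> (real ^ 'n \<Rightarrow> complex) set" where
  "Lp_space p = {f. f \<in> borel_measurable lebesgue \<and> Lp_qnorm p f < \<infinity>}"

definition Lp_loc_space :: "ennreal \<Rightarrow> (real ^ 'n \<Rightarrow> complex) set" where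
  "Lp_loc_space p = {f. \<forall>C. compact C \<longrightarrow> (\<lambda>x. indicator C x * f x) \<in> Lp_space p}"

text \<open>The quasi-norm of the sequence space \<open>b\<^sup>s\<^bsub>p,q\<^esub>\<close> over \<open>\<real>\<^sup>n\<close>, \<open>n = CARD('n)\<close>.\<close>

definition b_qnorm ::
  "real \<Rightarrow> ennreal \<Rightarrow> ennreal \<Rightarrow> (nat \<Rightarrow> int ^ 'n \<Rightarrow> complex) \<Rightarrow> ennreal" where
  "b_qnorm s p q lam =
     seq_qnorm q (\<lambda>j. ennreal (2 powr (real j * (s - real CARD('n) * enn2real (1 / p)))) *
                      seq_qnorm p (\<lambda>m. ennreal (cmod (lam j m))))"


subsection \<open>Smooth functions\<close>

definition partial_deriv ::
  "'n \<Rightarrow> (real ^ 'n \<Rightarrow> 'b::real_normed_vector) \<Rightarrow> real ^ 'n \<Rightarrow> 'b" where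
  "partial_deriv i f x = vector_derivative (\<lambda>t. f (x + t *\<^sub>R axis i 1)) (at 0)"

text \<open>
  Iterated partial derivatives are indexed by lists of coordinates. For \<open>C\<^sup>K\<close> functions the order
  is irrelevant, so the derivatives along lists of length at most K are precisely the
  derivatives of multi-index order at most K.
\<close>

definition iter_deriv ::
  "'n list \<Rightarrow> (real ^ 'n \<Rightarrow> 'b::real_normed_vector) \<Rightarrow> real ^ 'n \<Rightarrow> 'b" where
  "iter_deriv is f = foldr partial_deriv is f"

primrec Ck :: "nat \<Rightarrow> (real ^ 'n \<Rightarrow> 'b::real_normed_vector) \<Rightarrow> bool" where
  "Ck 0 f \<longleftrightarrow> continuous_on UNIV f"
| "Ck (Suc k) f \<longleftrightarrow>
     continuous_on UNIV f \<and>
     (\<forall>i. (\<forall>x. (\<lambda>t. f (x + t *\<^sub>R axis i 1)) differentiable (at (0::real))) \<and>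
          Ck k (partial_deriv i f))"

definition fun_support :: "(real ^ 'n \<Rightarrow> 'b::zero) \<Rightarrow> (real ^ 'n) set" where
  "fun_support f = closure {x. f x \<noteq> 0}"


subsection \<open>Besov spaces by atoms\<close>

definition lattice_point :: "int ^ 'n \<Rightarrow> real ^ 'n" where
  "lattice_point m = (\<chi> i. of_int (m $ i))"

text \<open>
  The closed cube \<open>d Q\<^bsub>j,m\<^esub>\<close>: centre \<open>2\<^bsup>-j\<^esup> m\<close>, side length \<open>d * 2\<^bsup>-j+1\<^esup>\<close>,
  hence half side length \<open>d * 2\<^bsup>-j\<^esup>\<close>.
\<close>

definition dcube :: "real \<Rightarrow> nat \<Rightarrow> int ^ 'n \<Rightarrow> (real ^ 'n) set" where
  "dcube d j m =
     {x. \<forall>i. \<bar>x $ i - 2 powr (- real j) * lattice_point m $ i\<bar> \<le> d * 2 powr (- real j)}"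

definition is_atom ::
  "real \<Rightarrow> nat \<Rightarrow> nat \<Rightarrow> int ^ 'n \<Rightarrow> (real ^ 'n \<Rightarrow> complex) \<Rightarrow> bool" where
  "is_atom d K j m a \<longleftrightarrow>
     Ck K a \<and> fun_support a \<subseteq> dcube d j m \<and>
     (\<forall>is. length is \<le> K \<longrightarrow>
        (\<forall>x. cmod (iter_deriv is a x) \<le> 2 powr (real (length is) * real j)))"

text \<open>
  For fixed j and x only finitely many terms of the sum over m are non-zero, so this sum is
  taken pointwise; the resulting series over j converges to f in \<open>L\<^sub>p\<close>. (For p < \<infinity> this
  agrees with unconditional \<open>L\<^sub>p\<close>-convergence of the double series; for p = \<infinity> the latter would
  be too restrictive.)
\<close>

definition atomic_representation ::
  "real \<Rightarrow> nat \<Rightarrow> real \<Rightarrow> ennreal \<Rightarrow> ennreal \<Rightarrow> (real ^ 'n \<Rightarrow> complex) \<Rightarrow>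
   (nat \<Rightarrow> int ^ 'n \<Rightarrow> complex) \<Rightarrow> (nat \<Rightarrow> int ^ 'n \<Rightarrow> real ^ 'n \<Rightarrow> complex) \<Rightarrow> bool" where
  "atomic_representation d K s p q f lam a \<longleftrightarrow>
     (\<forall>j m. is_atom d K j m (a j m)) \<and>
     b_qnorm s p q lam < \<infinity> \<and>
     (\<lambda>N. Lp_qnorm p (\<lambda>x. f x - (\<Sum>j<N. \<Sum>\<^sub>\<infinity>m. lam j m * a j m x))) \<longlonglongrightarrow> 0"

definition besov_space ::
  "real \<Rightarrow> nat \<Rightarrow> real \<Rightarrow> ennreal \<Rightarrow> ennreal \<Rightarrow> (real ^ 'n \<Rightarrow> complex) set" where
  "besov_space d K s p q =
     {f \<in> Lp_space p. \<exists>lam a. atomic_representation d K s p q f lam a}"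

text \<open>The quasi-norm is \<infinity> outside the space.\<close>

definition besov_qnorm ::
  "real \<Rightarrow> nat \<Rightarrow> real \<Rightarrow> ennreal \<Rightarrow> ennreal \<Rightarrow> (real ^ 'n \<Rightarrow> complex) \<Rightarrow> ennreal" where
  "besov_qnorm d K s p q f =
     (if f \<in> besov_space d K s p q
      then Inf {b_qnorm s p q lam | lam. \<exists>a. atomic_representation d K s p q f lam a}
      else \<infinity>)"


subsection \<open>Self-similar spaces\<close>

definition resolution_of_unity :: "(real ^ 'n \<Rightarrow> real) \<Rightarrow> bool" where
  "resolution_of_unity \<psi> \<longleftrightarrow>
     (\<forall>x. \<psi> x \<ge> 0) \<and> (\<forall>k. Ck k \<psi>) \<and>
     fun_support \<psi> \<subseteq> {y. norm y \<le> sqrt (real CARD('n))} \<and>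
     (\<forall>x. ((\<lambda>l. \<psi> (x - lattice_point l)) has_sum 1) UNIV)"

definition besov_selfs_space ::
  "(real ^ 'n \<Rightarrow> real) \<Rightarrow> real \<Rightarrow> nat \<Rightarrow> real \<Rightarrow> ennreal \<Rightarrow> ennreal \<Rightarrow>
   (real ^ 'n \<Rightarrow> complex) set" where
  "besov_selfs_space \<psi> d K s p q =
     {f \<in> Lp_loc_space (min 1 p).
        (SUP j::nat. SUP l. besov_qnorm d K s p q
           (\<lambda>x. complex_of_real (\<psi> (x - lattice_point l)) * f (2 powr (- real j) *\<^sub>R x))) < \<infinity>}"


subsection \<open>The condition on h\<close>

definition h_condition :: "nat \<Rightarrow> (real \<Rightarrow> real) \<Rightarrow> real \<Rightarrow> real \<Rightarrow> ennreal \<Rightarrow> bool" where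
  "h_condition n h \<sigma> p q \<longleftrightarrow>
     (let ratio = (\<lambda>j k. h (2 powr (- real j)) / h (2 powr (- real (j + k))) *
                         2 powr (- real (k * n)))
      in if q = \<infinity>
         then (SUP j::nat. SUP k::nat.
                 ennreal (2 powr (real k * \<sigma>) * ratio j k powr (1 / p))) < \<infinity>
         else (SUP j::nat. \<Sum>k::nat.
                 ennreal (2 powr (real k * \<sigma> * enn2real q) * ratio j k powr (enn2real q / p)))
               < \<infinity>)"

end

theory Submission
  imports Defs
begin

text \<open>
  Why the characteristic function belongs to the self-similar space. For fixed \<open>j\<close> and \<open>l\<close> the function
  \<open>\<psi>(x - l) \<chi>(2\<^bsup>-j\<^esup> x)\<close> is a smooth cut-off of the characteristic function of the dilated domain
  \<open>W = 2\<^bsup>j\<^esup> \<Omega>\<close>, and its Besov quasi-norm has to be bounded independently of \<open>j\<close> and \<open>l\<close>.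

  The translates of \<open>\<psi>(2\<^bsup>k\<^esup> x)\<close> that are supported in \<open>W\<close> add up to a smooth function \<open>T k\<close> between 0 and 1,
  which vanishes outside \<open>W\<close> and equals 1 at all points of \<open>W\<close> further than a multiple of \<open>2\<^bsup>-k\<^esup>\<close> from the
  complement (\<open>lattice_sum_inner_cells\<close>). Telescoping along \<open>k\<close> writes the function as the sum of the
  increments \<open>\<psi>(x - l) (T (k + 1) - T k)\<close>. Such an increment has derivatives of order \<open>i\<close> of size
  \<open>2\<^bsup>ki\<^esup>\<close> and, for \<open>k \<ge> 1\<close>, lives at distance at most a multiple of \<open>2\<^bsup>-k\<^esup>\<close> from the boundary. Another resolution of unity splits it into
  atoms, all with the same coefficient \<open>\<Lambda>\<close> (\<open>atomic_approximation\<close>). So the same \<open>\<psi>\<close> provides the cut-off,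
  the approximations and the localisation.

  The quasi-norm of the coefficients depends only on the number of atoms at each level. Here the measure
  \<open>\<mu>\<close> of the \<open>h\<close>-set enters: undoing the dilation, the atoms at level \<open>k\<close> belong to points of the boundary in
  a ball of radius about \<open>2\<^bsup>-j\<^esup>\<close>, the balls of radius \<open>2\<^bsup>-j-k\<^esup>\<close> around these points overlap boundedly
  often and have measure at least a multiple of \<open>h(2\<^bsup>-j-k\<^esup>)\<close>, while the total measure is at most a
  multiple of \<open>h(2\<^bsup>-j\<^esup>)\<close>. Hence there are at most \<open>C h(2\<^bsup>-j\<^esup>) / h(2\<^bsup>-j-k\<^esup>)\<close> atoms
  (\<open>card_boundary_cells_le\<close>). With the weight \<open>2\<^bsup>k(\<sigma> - n/p)\<^esup>\<close> of the sequence space the quasi-norm of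
  the coefficients becomes exactly the expression that the condition on \<open>h\<close> bounds uniformly in \<open>j\<close>
  (\<open>h_condition_seq_qnorm\<close>). The same count shows that the layer where \<open>T N\<close> differs from the
  characteristic function has volume \<open>O(2\<^bsup>-N\<sigma>p\<^esup>)\<close>, which gives the convergence in \<open>L\<^sub>p\<close>.
\<close>

section \<open>Functions with dyadic derivative bounds\<close>

text \<open>
  The factor \<open>C\<close> is a function of the point, not a constant: in a sum over all lattice translates of
  a bump only boundedly many translates are non-zero at any given point, and a pointwise factor
  that carries the indicator of the support keeps track of this through sums.
\<close>

definition deriv_bounded ::
  "nat \<Rightarrow> (real ^ 'n \<Rightarrow> real) \<Rightarrow> real \<Rightarrow> (real ^ 'n \<Rightarrow> 'b::real_normed_vector) \<Rightarrow> bool" where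
  "deriv_bounded K C M f \<longleftrightarrow>
     Ck K f \<and> (\<forall>is x. length is \<le> K \<longrightarrow> norm (iter_deriv is f x) \<le> C x * M ^ length is)"

lemma iter_deriv_Nil [simp]: "iter_deriv [] f = f"
  by (simp add: iter_deriv_def)

lemma iter_deriv_Cons: "iter_deriv (i # is) f = partial_deriv i (iter_deriv is f)"
  by (simp add: iter_deriv_def)

lemma iter_deriv_snoc: "iter_deriv (is @ [i]) f = iter_deriv is (partial_deriv i f)"
  by (simp add: iter_deriv_def)

lemma deriv_bounded_0: "deriv_bounded 0 C M f \<longleftrightarrow> continuous_on UNIV f \<and> (\<forall>x. norm (f x) \<le> C x)"
  by (simp add: deriv_bounded_def)

text \<open>
  This turns the definition by lists of directions into a recursion on the order, on which all
  closure properties below are proved by induction.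
\<close>

lemma deriv_bounded_Suc:
  fixes f :: "real ^ 'n \<Rightarrow> 'b::real_normed_vector"
  shows "deriv_bounded (Suc K) C M f \<longleftrightarrow>
     continuous_on UNIV f \<and> (\<forall>x. norm (f x) \<le> C x) \<and>
     (\<forall>i. (\<forall>x. (\<lambda>t. f (x + t *\<^sub>R axis i 1)) differentiable (at (0::real))) \<and>
          deriv_bounded K (\<lambda>x. C x * M) M (partial_deriv i f))"
proof -
  have "(\<forall>is x. length is \<le> Suc K \<longrightarrow> norm (iter_deriv is f x) \<le> C x * M ^ length is) \<longleftrightarrow>
     (\<forall>x. norm (f x) \<le> C x) \<and> (\<forall>i is x. length is \<le> K \<longrightarrow>
        norm (iter_deriv is (partial_deriv i f) x) \<le> C x * M * M ^ length is)"
    (is "?L \<longleftrightarrow> ?R")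
  proof
    assume L: ?L
    have "norm (f x) \<le> C x" for x
      using L[rule_format, of "[]"] by simp
    moreover have "norm (iter_deriv is (partial_deriv i f) x) \<le> C x * M * M ^ length is"
      if "length is \<le> K" for i "is" x
      using L[rule_format, of "is @ [i]" x] that by (simp add: iter_deriv_snoc mult_ac)
    ultimately show ?R by blast
  next
    assume R: ?R
    show ?L
    proof (intro allI impI)
      fix js :: "'n list" and x assume "length js \<le> Suc K"
      then show "norm (iter_deriv js f x) \<le> C x * M ^ length js"
        using R by (cases js rule: rev_cases) (auto simp: iter_deriv_snoc mult_ac)
    qed
  qed
  then show ?thesis
    unfolding deriv_bounded_def by auto
qed

lemma Ck_Suc_imp_Ck: "Ck (Suc K) f \<Longrightarrow> Ck K f"
proof (induction K arbitrary: f)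
  case (Suc K)
  then have "Ck K (partial_deriv i f)" for i by (auto intro: Suc.IH)
  with Suc.prems show ?case by simp
qed simp

lemma deriv_bounded_SucD: "deriv_bounded (Suc K) C M f \<Longrightarrow> deriv_bounded K C M f"
  unfolding deriv_bounded_def using Ck_Suc_imp_Ck by (metis le_SucI)

lemma deriv_bounded_mono:
  fixes f :: "real ^ 'n \<Rightarrow> 'b::real_normed_vector"
  assumes "deriv_bounded K C M f" "\<And>x. C x \<le> C' x" "0 \<le> M" "M \<le> M'" "\<And>x. 0 \<le> C' x"
  shows "deriv_bounded K C' M' f"
  unfolding deriv_bounded_def
proof (intro conjI allI impI)
  show "Ck K f" using assms by (simp add: deriv_bounded_def)
  fix js :: "'n list" and x assume "length js \<le> K"
  then have "norm (iter_deriv js f x) \<le> C x * M ^ length js"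
    using assms by (simp add: deriv_bounded_def)
  also have "\<dots> \<le> C' x * M' ^ length js"
    using assms by (intro mult_mono power_mono) auto
  finally show "norm (iter_deriv js f x) \<le> C' x * M' ^ length js" .
qed

lemma has_partial_deriv:
  assumes "(\<lambda>t. f (x + t *\<^sub>R axis i 1)) differentiable (at (0::real))"
  shows "((\<lambda>t. f (x + t *\<^sub>R axis i 1)) has_vector_derivative partial_deriv i f x) (at 0)"
  using assms unfolding partial_deriv_def by (simp add: vector_derivative_works)

lemma partial_derivI:
  assumes "\<And>x. ((\<lambda>t. f (x + t *\<^sub>R axis i 1)) has_vector_derivative f' x) (at (0::real))"
  shows "partial_deriv i f = f'" "(\<lambda>t. f (x + t *\<^sub>R axis i 1)) differentiable (at (0::real))"
  using assms[THEN vector_derivative_at] assms[THEN differentiableI_vector]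
  by (auto simp: partial_deriv_def fun_eq_iff)

lemma deriv_bounded_SucI:
  assumes "continuous_on UNIV f" "\<And>x. norm (f x) \<le> C x"
    and "\<And>i x. ((\<lambda>t. f (x + t *\<^sub>R axis i 1)) has_vector_derivative f' i x) (at (0::real))"
    and "\<And>i. deriv_bounded K (\<lambda>x. C x * M) M (f' i)"
  shows "deriv_bounded (Suc K) C M f"
proof -
  have "partial_deriv i f = f' i" for i by (rule partial_derivI(1)) (rule assms(3))
  then show ?thesis
    using assms(1,2,4) partial_derivI(2)[OF assms(3)] by (simp add: deriv_bounded_Suc)
qed

lemma deriv_bounded_SucE:
  assumes "deriv_bounded (Suc K) C M f"
  shows "((\<lambda>t. f (x + t *\<^sub>R axis i 1)) has_vector_derivative partial_deriv i f x) (at (0::real))"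
    "deriv_bounded K (\<lambda>x. C x * M) M (partial_deriv i f)"
    "continuous_on UNIV f" "norm (f x) \<le> C x" "deriv_bounded K C M f"
  using assms deriv_bounded_SucD[OF assms] by (auto simp: deriv_bounded_Suc has_partial_deriv)

lemma deriv_bounded_add:
  assumes "deriv_bounded K C1 M f" "deriv_bounded K C2 M g"
  shows "deriv_bounded K (\<lambda>x. C1 x + C2 x) M (\<lambda>x. f x + g x)"
  using assms
proof (induction K arbitrary: C1 C2 f g)
  case 0
  then show ?case by (auto simp: deriv_bounded_0 intro!: continuous_intros norm_triangle_mono)
next
  case (Suc K)
  note f = deriv_bounded_SucE[OF Suc.prems(1)] and g = deriv_bounded_SucE[OF Suc.prems(2)]
  show ?case
  proof (rule deriv_bounded_SucI)
    show "((\<lambda>t. f (x + t *\<^sub>R axis i 1) + g (x + t *\<^sub>R axis i 1)) has_vector_derivative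
       partial_deriv i f x + partial_deriv i g x) (at 0)" for i x
      by (intro has_vector_derivative_add f g)
    show "deriv_bounded K (\<lambda>x. (C1 x + C2 x) * M) M (\<lambda>x. partial_deriv i f x + partial_deriv i g x)"
      for i using Suc.IH[OF f(2) g(2)] by (simp add: distrib_right)
  qed (auto intro!: continuous_intros f g norm_triangle_mono)
qed

text \<open>
  By the product rule, the constants multiply and the scales \<open>M\<close> add:
  \<open>C1 M1 C2 + C1 C2 M2 = C1 C2 (M1 + M2)\<close>.
\<close>

lemma deriv_bounded_mult:
  fixes f g :: "real ^ 'n \<Rightarrow> 'b::real_normed_algebra"
  assumes "deriv_bounded K C1 M1 f" "deriv_bounded K C2 M2 g"
  shows "deriv_bounded K (\<lambda>x. C1 x * C2 x) (M1 + M2) (\<lambda>x. f x * g x)"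
  using assms
proof (induction K arbitrary: C1 C2 f g)
  case 0
  have "norm (f x * g x) \<le> C1 x * C2 x" for x
    using 0 norm_mult_ineq[of "f x" "g x"]
    by (meson deriv_bounded_0 mult_mono norm_ge_zero order_trans)
  with 0 show ?case by (auto simp: deriv_bounded_0 intro!: continuous_intros)
next
  case (Suc K)
  note f = deriv_bounded_SucE[OF Suc.prems(1)] and g = deriv_bounded_SucE[OF Suc.prems(2)]
  show ?case
  proof (rule deriv_bounded_SucI)
    show "norm (f x * g x) \<le> C1 x * C2 x" for x
      using f(4) g(4) norm_mult_ineq[of "f x" "g x"]
      by (meson mult_mono norm_ge_zero order_trans)
    show "((\<lambda>t. f (x + t *\<^sub>R axis i 1) * g (x + t *\<^sub>R axis i 1)) has_vector_derivative
       f x * partial_deriv i g x + partial_deriv i f x * g x) (at 0)" for i x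
      using has_vector_derivative_mult[OF f(1)[of x i] g(1)[of x i]] by simp
    show "deriv_bounded K (\<lambda>x. C1 x * C2 x * (M1 + M2)) (M1 + M2)
        (\<lambda>x. f x * partial_deriv i g x + partial_deriv i f x * g x)" for i
      using deriv_bounded_add[OF Suc.IH[OF f(5) g(2)] Suc.IH[OF f(2) g(5)]]
      by (simp add: algebra_simps)
  qed (auto intro!: continuous_intros f g)
qed

lemma deriv_bounded_linear:
  assumes L: "bounded_linear L" and B: "\<And>y. norm (L y) \<le> B * norm y" "0 \<le> B"
    and "deriv_bounded K C M f"
  shows "deriv_bounded K (\<lambda>x. B * C x) M (\<lambda>x. L (f x))"
  using assms(4)
proof (induction K arbitrary: C f)
  case 0
  have "norm (L (f x)) \<le> B * C x" for x
    using 0 B(1)[of "f x"] by (meson B(2) deriv_bounded_0 mult_left_mono order_trans)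
  with 0 show ?case
    by (auto simp: deriv_bounded_0 intro!: bounded_linear.continuous_on[OF L])
next
  case (Suc K)
  note f = deriv_bounded_SucE[OF Suc.prems(1)]
  show ?case
  proof (rule deriv_bounded_SucI)
    show "norm (L (f x)) \<le> B * C x" for x
      using f(4) B(1)[of "f x"] by (meson B(2) mult_left_mono order_trans)
    show "((\<lambda>t. L (f (x + t *\<^sub>R axis i 1))) has_vector_derivative L (partial_deriv i f x)) (at 0)" for i x
      by (rule bounded_linear.has_vector_derivative[OF L f(1)])
    show "deriv_bounded K (\<lambda>x. B * C x * M) M (\<lambda>x. L (partial_deriv i f x))" for i
      using Suc.IH[OF f(2)] by (simp add: mult.assoc)
  qed (intro bounded_linear.continuous_on[OF L] f)
qed

lemma deriv_bounded_affine:
  assumes "deriv_bounded K C M f" "0 \<le> t"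
  shows "deriv_bounded K (\<lambda>x. C (t *\<^sub>R x - b)) (M * t) (\<lambda>x. f (t *\<^sub>R x - b))"
  using assms(1)
proof (induction K arbitrary: C f)
  case 0
  then show ?case
    by (auto simp: deriv_bounded_0 intro!: continuous_on_compose2[of UNIV f] continuous_intros)
next
  case (Suc K)
  note f = deriv_bounded_SucE[OF Suc.prems(1)]
  show ?case
  proof (rule deriv_bounded_SucI)
    show "((\<lambda>s. f (t *\<^sub>R (x + s *\<^sub>R axis i 1) - b)) has_vector_derivative
       t *\<^sub>R partial_deriv i f (t *\<^sub>R x - b)) (at 0)" for i x
    proof -
      have s: "((\<lambda>s. t * s) has_vector_derivative t) (at 0)"
        by (auto intro!: derivative_eq_intros simp: has_vector_derivative_def)
      have "((\<lambda>s. f ((t *\<^sub>R x - b) + s *\<^sub>R axis i 1)) has_vector_derivative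
          partial_deriv i f (t *\<^sub>R x - b)) (at (t * 0))"
        using f(1) by simp
      from vector_diff_chain_at[OF s this] show ?thesis
        by (simp add: o_def algebra_simps)
    qed
    have "norm (t *\<^sub>R y) \<le> t * norm y" for y :: 'b using \<open>0 \<le> t\<close> by simp
    from deriv_bounded_linear[OF bounded_linear_scaleR_right this \<open>0 \<le> t\<close> Suc.IH[OF f(2)]]
    show "deriv_bounded K (\<lambda>x. C (t *\<^sub>R x - b) * (M * t)) (M * t)
        (\<lambda>x. t *\<^sub>R partial_deriv i f (t *\<^sub>R x - b))" for i
      by (simp add: mult_ac)
    show "continuous_on UNIV (\<lambda>x. f (t *\<^sub>R x - b))"
      using f(3) by (auto intro!: continuous_on_compose2[of UNIV f] continuous_intros)
  qed (rule f)
qed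

lemma deriv_bounded_zero: "deriv_bounded K (\<lambda>x. 0) M (\<lambda>x. 0)"
proof (induction K)
  case (Suc K)
  then show ?case by (intro deriv_bounded_SucI[where f' = "\<lambda>_ _. 0"]) auto
qed (simp add: deriv_bounded_0)

lemma deriv_bounded_sum:
  assumes "finite A" "\<And>l. l \<in> A \<Longrightarrow> deriv_bounded K (C l) M (f l)"
  shows "deriv_bounded K (\<lambda>x. \<Sum>l\<in>A. C l x) M (\<lambda>x. \<Sum>l\<in>A. f l x)"
  using assms by (induction A rule: finite_induct) (simp_all add: deriv_bounded_zero deriv_bounded_add)

lemma iter_deriv_eq_0_on_open:
  assumes "open U" "\<And>x. x \<in> U \<Longrightarrow> f x = 0" "x \<in> U"
  shows "iter_deriv is f x = 0"
  using assms(3)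
proof (induction "is" arbitrary: x)
  case (Cons i js)
  let ?l = "\<lambda>t::real. x + t *\<^sub>R axis i 1"
  have "open (?l -` U)"
    by (intro open_vimage assms continuous_intros)
  then have "((\<lambda>t. iter_deriv js f (?l t)) has_vector_derivative 0) (at 0)"
    by (rule has_vector_derivative_transform_within_open[OF has_vector_derivative_const])
      (use Cons in auto)
  then show ?case
    by (simp add: iter_deriv_Cons partial_deriv_def vector_derivative_at)
qed (use assms in simp)

lemma Ck_imp_continuous_iter_deriv:
  assumes "Ck K f" "length is \<le> K"
  shows "continuous_on UNIV (iter_deriv is f)"
  using assms
proof (induction K arbitrary: f "is")
  case (Suc K)
  then show ?case
    by (cases "is" rule: rev_cases) (auto simp: iter_deriv_snoc)
qed auto

lemma smooth_compact_support_deriv_bounded: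
  fixes f :: "real ^ 'n \<Rightarrow> 'b::real_normed_vector"
  assumes "Ck K f" "compact (fun_support f)"
  obtains C where "0 \<le> C" "deriv_bounded K (\<lambda>x. C * indicator (fun_support f) x) 1 f"
proof -
  define B where "B js = (SOME b. 0 \<le> b \<and> (\<forall>x. norm (iter_deriv js f x) \<le> b * indicator (fun_support f) x))"
    for js
  have B: "0 \<le> B js \<and> (\<forall>x. norm (iter_deriv js f x) \<le> B js * indicator (fun_support f) x)"
    if "length js \<le> K" for js
    unfolding B_def
  proof (rule someI_ex)
    have "compact (iter_deriv js f ` fun_support f)"
      using assms Ck_imp_continuous_iter_deriv[OF assms(1) that]
      by (intro compact_continuous_image) (auto intro: continuous_on_subset)
    then have "bounded (iter_deriv js f ` fun_support f)"
      by (rule compact_imp_bounded)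
    then obtain b where b: "\<And>x. x \<in> fun_support f \<Longrightarrow> norm (iter_deriv js f x) \<le> b" "b > 0"
      unfolding bounded_pos by auto
    have "iter_deriv js f x = 0" if "x \<notin> fun_support f" for x
      using that assms(2) closure_subset[of "{x. f x \<noteq> 0}"]
      by (intro iter_deriv_eq_0_on_open[of "- fun_support f"])
        (auto simp: fun_support_def)
    with b show "\<exists>b. 0 \<le> b \<and> (\<forall>x. norm (iter_deriv js f x) \<le> b * indicator (fun_support f) x)"
      by (intro exI[of _ b]) (auto simp: indicator_def)
  qed
  let ?J = "{js :: 'n list. length js \<le> K}"
  have fin: "finite ?J" using finite_lists_length_le[of "UNIV :: 'n set" K] by simp
  show thesis
  proof
    show "0 \<le> (\<Sum>js\<in>?J. B js)" using B by (intro sum_nonneg) auto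
    show "deriv_bounded K (\<lambda>x. (\<Sum>js\<in>?J. B js) * indicator (fun_support f) x) 1 f"
      unfolding deriv_bounded_def
    proof (intro conjI allI impI assms)
      fix js :: "'n list" and x assume js: "length js \<le> K"
      have "B js \<le> (\<Sum>js\<in>?J. B js)"
        using js B by (intro member_le_sum fin) auto
      then have "B js * indicator (fun_support f) x \<le> (\<Sum>js\<in>?J. B js) * indicator (fun_support f) x"
        by (rule mult_right_mono) simp
      with B[OF js] show "norm (iter_deriv js f x) \<le> (\<Sum>js\<in>?J. B js) * indicator (fun_support f) x * 1 ^ length js"
        by (auto intro: order_trans)
    qed
  qed
qed

section \<open>Lattice sums of a smooth resolution of unity\<close>

lemma norm_le_sqrt_card:
  fixes x :: "real ^ 'n"
  assumes "\<And>i. \<bar>x $ i\<bar> \<le> r"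
  shows "norm x \<le> sqrt (real CARD('n)) * r"
proof -
  have r: "0 \<le> r" using assms[of undefined] by linarith
  have "norm x \<le> sqrt (\<Sum>i\<in>(UNIV::'n set). r\<^sup>2)"
    unfolding norm_vec_def L2_set_def
    by (intro real_sqrt_le_mono sum_mono power_mono) (simp_all add: assms)
  also have "\<dots> = sqrt (real CARD('n)) * r" using r by (simp add: real_sqrt_mult)
  finally show ?thesis .
qed

lemma lattice_point_minus: "lattice_point (m - l) = lattice_point m - lattice_point l"
  by (simp add: lattice_point_def vec_eq_iff)

lemma lattice_point_near:
  fixes y :: "real ^ 'n"
  obtains m :: "int ^ 'n" where "\<And>i. \<bar>y $ i - lattice_point m $ i\<bar> \<le> 1"
    "norm (y - lattice_point m) \<le> sqrt (real CARD('n))"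
proof
  let ?m = "(\<chi> i. \<lfloor>y $ i\<rfloor>) :: int ^ 'n"
  show c: "\<bar>y $ i - lattice_point ?m $ i\<bar> \<le> 1" for i
    by (simp add: lattice_point_def) linarith
  then show "norm (y - lattice_point ?m) \<le> sqrt (real CARD('n))"
    using norm_le_sqrt_card[of "y - lattice_point ?m" 1] by simp
qed

lemma finite_lattice_cball:
  fixes y :: "real ^ 'n"
  shows "finite {m :: int ^ 'n. norm (lattice_point m - y) \<le> R}"
proof (rule finite_subset)
  let ?I = "\<lambda>i. {\<lfloor>y $ i - R\<rfloor>..\<lceil>y $ i + R\<rceil>}"
  show "{m. norm (lattice_point m - y) \<le> R} \<subseteq> vec_lambda ` (PiE UNIV ?I)"
  proof
    fix m :: "int ^ 'n" assume "m \<in> {m. norm (lattice_point m - y) \<le> R}"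
    then have *: "\<bar>lattice_point m $ i - y $ i\<bar> \<le> R" for i
      using component_le_norm_cart[of "lattice_point m - y" i] by simp
    have "m $ i \<in> ?I i" for i
      using *[of i] by (simp add: lattice_point_def) linarith
    then have "(\<lambda>i. m $ i) \<in> PiE UNIV ?I" by auto
    then show "m \<in> vec_lambda ` (PiE UNIV ?I)"
      by (intro image_eqI[where x = "\<lambda>i. m $ i"]) simp_all
  qed
  show "finite (vec_lambda ` (PiE UNIV ?I))"
    by (intro finite_imageI finite_PiE) auto
qed

text \<open>
  Rounding the centre \<open>y\<close> to a lattice point reduces to one fixed ball around the origin, so the bound
  is uniform in \<open>y\<close>.
\<close>

lemma card_lattice_cball_bounded:
  obtains N :: nat where
    "\<And>y :: real ^ 'n. card {m :: int ^ 'n. norm (lattice_point m - y) \<le> R} \<le> N"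
proof
  fix y :: "real ^ 'n"
  obtain l :: "int ^ 'n" where l: "norm (y - lattice_point l) \<le> sqrt (real CARD('n))"
    using lattice_point_near by metis
  have "norm (lattice_point (m - l)) \<le> R + sqrt (real CARD('n))"
    if "norm (lattice_point m - y) \<le> R" for m
    using norm_triangle_ineq[of "lattice_point m - y" "y - lattice_point l"] l that
    by (simp add: lattice_point_minus)
  then have "(\<lambda>m. m - l) ` {m. norm (lattice_point m - y) \<le> R} \<subseteq>
      {m. norm (lattice_point m - 0) \<le> R + sqrt (real CARD('n))}"
    by auto
  from card_mono[OF finite_lattice_cball this]
  show "card {m. norm (lattice_point m - y) \<le> R} \<le>
      card {m :: int ^ 'n. norm (lattice_point m - 0) \<le> R + sqrt (real CARD('n))}"
    by (subst (asm) card_image) (auto simp: inj_on_def)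
qed

definition lattice_sum :: "(real ^ 'n \<Rightarrow> real) \<Rightarrow> nat \<Rightarrow> (int ^ 'n) set \<Rightarrow> real ^ 'n \<Rightarrow> real" where
  "lattice_sum \<psi> k A x = (\<Sum>l\<in>A. \<psi> (2 ^ k *\<^sub>R x - lattice_point l))"

text \<open>
  The ball of a cell contains the support of its rescaled bump. The sum of the bumps of these cells is
  the smooth approximation of the characteristic function of \<open>W\<close> at scale \<open>2\<^bsup>-k\<^esup>\<close>.
\<close>

definition inner_cells :: "(real ^ 'n) set \<Rightarrow> nat \<Rightarrow> (int ^ 'n) set" where
  "inner_cells W k =
     {l. cball ((1 / 2 ^ k) *\<^sub>R lattice_point l) (sqrt (real CARD('n)) / 2 ^ k) \<subseteq> W}"

text \<open>
  The one-sided boundary layer. The smooth approximations of the characteristic function are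
  exact outside \<open>W\<close>, so they can only fail inside.
\<close>

definition inner_layer :: "'a::metric_space set \<Rightarrow> real \<Rightarrow> 'a set" where
  "inner_layer W r = {x \<in> W. \<not> cball x r \<subseteq> W}"

text \<open>
  The descendants of the cell \<open>m\<close> after \<open>c\<close> dyadic subdivisions. The bumps of a resolution of unity may
  be too wide for the cube of an atom when \<open>d\<close> is close to 1; the sum of the \<open>2\<^bsup>c\<^esup>\<close> times finer bumps
  over a block is supported in the cube enlarged by the factor \<open>1 + sqrt n * 2\<^bsup>-c\<^esup>\<close> only.
\<close>

definition block :: "nat \<Rightarrow> int ^ 'n \<Rightarrow> (int ^ 'n) set" where
  "block c m = {l. \<forall>i. (l $ i) div 2 ^ c = m $ i}"

lemma rescale_dist:
  fixes x y :: "'a::real_normed_vector"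
  shows "dist ((1 / 2 ^ k) *\<^sub>R y) x = norm (2 ^ k *\<^sub>R x - y) / 2 ^ k"
proof -
  have "(1 / 2 ^ k) *\<^sub>R y - x = (1 / 2 ^ k) *\<^sub>R (y - 2 ^ k *\<^sub>R x)"
    by (simp add: scaleR_diff_right)
  then have "dist ((1 / 2 ^ k) *\<^sub>R y) x = norm ((1 / 2 ^ k) *\<^sub>R (y - 2 ^ k *\<^sub>R x))"
    by (simp add: dist_norm)
  then show ?thesis by (simp add: norm_minus_commute)
qed

lemma finite_inner_cells:
  fixes W :: "(real ^ 'n) set"
  assumes "bounded W"
  shows "finite (inner_cells W k)"
proof -
  obtain b where b: "\<And>x. x \<in> W \<Longrightarrow> norm x \<le> b"
    using assms by (auto simp: bounded_iff)
  have "norm (lattice_point l - 0) \<le> 2 ^ k * b" if "l \<in> inner_cells W k" for l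
  proof -
    have "(1 / 2 ^ k) *\<^sub>R lattice_point l \<in> W"
      using that unfolding inner_cells_def by (auto simp: subset_iff)
    from b[OF this] show ?thesis by (simp add: field_simps)
  qed
  then show ?thesis by (intro finite_subset[OF _ finite_lattice_cball[of 0 "2 ^ k * b"]]) auto
qed

lemma block_remainder:
  assumes "l \<in> block c m"
  shows "0 \<le> lattice_point l $ i - 2 ^ c * lattice_point m $ i"
    "lattice_point l $ i - 2 ^ c * lattice_point m $ i \<le> 2 ^ c"
proof -
  have "l $ i = 2 ^ c * (m $ i) + (l $ i) mod 2 ^ c"
    using assms mult_div_mod_eq[of "2 ^ c" "l $ i"] by (simp add: block_def)
  moreover have "0 \<le> (l $ i) mod 2 ^ c" "(l $ i) mod 2 ^ c < 2 ^ c" by simp_all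
  ultimately have "2 ^ c * (m $ i) \<le> l $ i" "l $ i \<le> 2 ^ c * (m $ i) + 2 ^ c" by linarith+
  then have "real_of_int (2 ^ c * (m $ i)) \<le> real_of_int (l $ i)"
    "real_of_int (l $ i) \<le> real_of_int (2 ^ c * (m $ i) + 2 ^ c)" by linarith+
  then show "0 \<le> lattice_point l $ i - 2 ^ c * lattice_point m $ i"
    "lattice_point l $ i - 2 ^ c * lattice_point m $ i \<le> 2 ^ c"
    by (simp_all add: lattice_point_def)
qed

lemma finite_block: "finite (block c (m :: int ^ 'n))"
proof (rule finite_subset[OF _ finite_lattice_cball])
  show "block c m \<subseteq> {l. norm (lattice_point l - 2 ^ c *\<^sub>R lattice_point m)
      \<le> sqrt (real CARD('n)) * 2 ^ c}"
    using block_remainder[of _ c m]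
    by (intro subsetI CollectI norm_le_sqrt_card) (fastforce simp: abs_le_iff)
qed

locale smooth_resolution =
  fixes \<psi> :: "real ^ 'n \<Rightarrow> real"
  assumes resolution: "resolution_of_unity \<psi>"
begin

lemma psi_nonneg: "0 \<le> \<psi> x"
  using resolution by (simp add: resolution_of_unity_def)

lemma psi_support: "\<psi> x \<noteq> 0 \<Longrightarrow> norm x \<le> sqrt (real CARD('n))"
  using resolution closure_subset[of "{x. \<psi> x \<noteq> 0}"]
  unfolding resolution_of_unity_def fun_support_def by blast

lemma finite_active: "finite {l. \<psi> (y - lattice_point l) \<noteq> 0}"
  by (rule finite_subset[OF _ finite_lattice_cball[of y "sqrt (real CARD('n))"]])
    (use psi_support in \<open>auto simp: norm_minus_commute\<close>)

lemma sum_psi: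
  assumes "finite P"
  shows "(\<Sum>l\<in>P. \<psi> (y - lattice_point l)) \<le> 1"
    and "(\<And>l. \<psi> (y - lattice_point l) \<noteq> 0 \<Longrightarrow> l \<in> P) \<Longrightarrow> (\<Sum>l\<in>P. \<psi> (y - lattice_point l)) = 1"
proof -
  have hs: "((\<lambda>l. \<psi> (y - lattice_point l)) has_sum 1) UNIV"
    using resolution by (simp add: resolution_of_unity_def)
  show "(\<Sum>l\<in>P. \<psi> (y - lattice_point l)) \<le> 1"
    by (rule has_sum_mono_neutral[OF has_sum_finite[OF assms] hs]) (auto intro: psi_nonneg)
  assume *: "\<And>l. \<psi> (y - lattice_point l) \<noteq> 0 \<Longrightarrow> l \<in> P"
  have "((\<lambda>l. \<psi> (y - lattice_point l)) has_sum 1) P"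
    using hs * by (subst has_sum_cong_neutral[where T = UNIV and g = "\<lambda>l. \<psi> (y - lattice_point l)"]) auto
  then show "(\<Sum>l\<in>P. \<psi> (y - lattice_point l)) = 1"
    using assms by (metis has_sum_finite has_sum_unique)
qed

lemma psi_le_1: "\<psi> x \<le> 1"
  using sum_psi(1)[of "{0}" x] by (simp add: lattice_point_def zero_vec_def[symmetric])

lemma lattice_sum_bounds:
  assumes "finite A"
  shows "0 \<le> lattice_sum \<psi> k A x" "lattice_sum \<psi> k A x \<le> 1"
  using sum_psi(1)[OF assms] by (auto simp: lattice_sum_def intro!: sum_nonneg psi_nonneg)

text \<open>
  A bump that is non-zero at \<open>x\<close> is supported in the ball around \<open>x\<close> of twice its radius. If that ball
  lies in \<open>W\<close>, all bumps that see \<open>x\<close> are selected and add up to 1. If \<open>x\<close> is outside \<open>W\<close>, none is.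
\<close>

lemma lattice_sum_inner_cells:
  assumes "bounded W" "x \<notin> inner_layer W (2 * sqrt (real CARD('n)) / 2 ^ k)"
  shows "lattice_sum \<psi> k (inner_cells W k) x = indicator W x"
proof (cases "x \<in> W")
  case False
  have "\<psi> (2 ^ k *\<^sub>R x - lattice_point l) = 0" if "l \<in> inner_cells W k" for l
  proof (rule ccontr)
    assume "\<psi> (2 ^ k *\<^sub>R x - lattice_point l) \<noteq> 0"
    then have "x \<in> cball ((1 / 2 ^ k) *\<^sub>R lattice_point l) (sqrt (real CARD('n)) / 2 ^ k)"
      using psi_support by (auto simp: rescale_dist intro!: divide_right_mono)
    then show False using that False unfolding inner_cells_def by auto
  qed
  then show ?thesis using False by (simp add: lattice_sum_def)
next
  case True
  then have sub: "cball x (2 * sqrt (real CARD('n)) / 2 ^ k) \<subseteq> W"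
    using assms(2) by (auto simp: inner_layer_def)
  have "l \<in> inner_cells W k" if "\<psi> (2 ^ k *\<^sub>R x - lattice_point l) \<noteq> 0" for l
    unfolding inner_cells_def mem_Collect_eq
  proof (rule order_trans[OF _ sub])
    have "dist ((1 / 2 ^ k) *\<^sub>R lattice_point l) x \<le> sqrt (real CARD('n)) / 2 ^ k"
      using psi_support[OF that] by (auto simp: rescale_dist intro!: divide_right_mono)
    then show "cball ((1 / 2 ^ k) *\<^sub>R lattice_point l) (sqrt (real CARD('n)) / 2 ^ k) \<subseteq> cball x (2 * sqrt (real CARD('n)) / 2 ^ k)"
    proof (intro subsetI)
      fix y assume "y \<in> cball ((1 / 2 ^ k) *\<^sub>R lattice_point l) (sqrt (real CARD('n)) / 2 ^ k)"
      then have "dist ((1 / 2 ^ k) *\<^sub>R lattice_point l) y \<le> sqrt (real CARD('n)) / 2 ^ k" by simp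
      with \<open>dist ((1 / 2 ^ k) *\<^sub>R lattice_point l) x \<le> _\<close>
      have "dist x y \<le> sqrt (real CARD('n)) / 2 ^ k + sqrt (real CARD('n)) / 2 ^ k"
        using dist_triangle[of x y "(1 / 2 ^ k) *\<^sub>R lattice_point l"]
          dist_commute[of x "(1 / 2 ^ k) *\<^sub>R lattice_point l"] by linarith
      then show "y \<in> cball x (2 * sqrt (real CARD('n)) / 2 ^ k)" by simp
    qed
  qed
  then show ?thesis
    using True unfolding lattice_sum_def by (simp add: sum_psi(2) finite_inner_cells assms)
qed

text \<open>
  The blocks partition the lattice, so the block sums are again a resolution of unity.
\<close>

lemma has_sum_blocks: "((\<lambda>m. lattice_sum \<psi> k (block c m) x) has_sum 1) UNIV"
proof -
  let ?f = "\<lambda>l. \<psi> (2 ^ k *\<^sub>R x - lattice_point l)"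
  define P where "P = {l. ?f l \<noteq> 0}"
  define g :: "int ^ 'n \<Rightarrow> int ^ 'n" where "g l = (\<chi> i. (l $ i) div 2 ^ c)" for l
  have g: "l \<in> block c m \<longleftrightarrow> g l = m" for l m
    by (auto simp: block_def g_def vec_eq_iff)
  have P: "finite P" unfolding P_def by (rule finite_active)
  have eq: "lattice_sum \<psi> k (block c m) x = (\<Sum>l\<in>{l \<in> P. g l = m}. ?f l)" for m
    unfolding lattice_sum_def
    by (rule sum.mono_neutral_right) (auto simp: g P_def finite_block)
  have "(\<Sum>m\<in>g ` P. \<Sum>l\<in>{l \<in> P. g l = m}. ?f l) = sum ?f P"
    by (rule sum.group) (use P in auto)
  also have "\<dots> = 1" by (rule sum_psi(2)[OF P]) (simp add: P_def)
  finally have 1: "(\<Sum>m\<in>g ` P. lattice_sum \<psi> k (block c m) x) = 1" by (simp add: eq)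
  have "lattice_sum \<psi> k (block c m) x = 0" if "m \<notin> g ` P" for m
    unfolding eq by (rule sum.neutral) (use that in auto)
  with 1 show ?thesis
    using has_sum_finite_neutralI[of "g ` P" UNIV "\<lambda>m. lattice_sum \<psi> k (block c m) x" 1] P by auto
qed

lemma block_sum_support:
  assumes "lattice_sum \<psi> (k + c) (block c m) x \<noteq> 0" "1 + sqrt (real CARD('n)) / 2 ^ c \<le> d"
  shows "\<bar>2 ^ k * x $ i - lattice_point m $ i\<bar> \<le> d"
proof -
  obtain l where l: "l \<in> block c m" "\<psi> (2 ^ (k + c) *\<^sub>R x - lattice_point l) \<noteq> 0"
    using assms(1) unfolding lattice_sum_def by (meson sum.not_neutral_contains_not_neutral)
  have "\<bar>2 ^ (k + c) * x $ i - lattice_point l $ i\<bar> \<le> sqrt (real CARD('n))"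
    using component_le_norm_cart[of "2 ^ (k + c) *\<^sub>R x - lattice_point l" i] psi_support[OF l(2)]
    by simp
  then have "\<bar>2 ^ (k + c) * x $ i - 2 ^ c * lattice_point m $ i\<bar> \<le> sqrt (real CARD('n)) + 2 ^ c"
    using block_remainder[OF l(1), of i] by linarith
  also have "2 ^ (k + c) * x $ i - 2 ^ c * lattice_point m $ i = 2 ^ c * (2 ^ k * x $ i - lattice_point m $ i)"
    by (simp add: power_add algebra_simps)
  finally have "\<bar>2 ^ k * x $ i - lattice_point m $ i\<bar> \<le> (sqrt (real CARD('n)) + 2 ^ c) / 2 ^ c"
    by (simp only: abs_mult pos_le_divide_eq zero_less_power zero_less_numeral)
      (simp add: mult.commute)
  also have "\<dots> \<le> d" using assms(2) by (simp add: field_simps)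
  finally show ?thesis .
qed

text \<open>
  At each point at most boundedly many translates are non-zero, which makes the bound independent of
  the index set \<open>A\<close>.
\<close>

lemma lattice_sum_deriv_bounded:
  obtains B where "0 \<le> B"
    "\<And>k A. finite A \<Longrightarrow> deriv_bounded K (\<lambda>x. B) (2 ^ k) (lattice_sum \<psi> k A)"
proof -
  have sub: "fun_support \<psi> \<subseteq> cball 0 (sqrt (real CARD('n)))"
    using resolution by (auto simp: resolution_of_unity_def)
  then have "compact (fun_support \<psi>)"
    using bounded_subset[OF bounded_cball] closed_closure
    by (auto simp: fun_support_def compact_eq_bounded_closed)
  then obtain C where C: "0 \<le> C" "deriv_bounded K (\<lambda>x. C * indicator (fun_support \<psi>) x) 1 \<psi>"
    using smooth_compact_support_deriv_bounded[of K \<psi>] resolution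
    by (auto simp: resolution_of_unity_def)
  obtain N :: nat where N: "\<And>y :: real ^ 'n. card {m :: int ^ 'n. norm (lattice_point m - y) \<le> sqrt (real CARD('n))} \<le> N"
    using card_lattice_cball_bounded[of "sqrt (real CARD('n))"] by blast
  show thesis
  proof
    show "0 \<le> C * N" using C by simp
    fix k and A :: "(int ^ 'n) set" assume A: "finite A"
    let ?C = "\<lambda>l x. C * indicator (fun_support \<psi>) (2 ^ k *\<^sub>R x - lattice_point l)"
    have "deriv_bounded K (?C l) (1 * 2 ^ k) (\<lambda>x. \<psi> (2 ^ k *\<^sub>R x - lattice_point l))" for l
      by (rule deriv_bounded_affine[OF C(2)]) simp
    then have "deriv_bounded K (\<lambda>x. \<Sum>l\<in>A. ?C l x) (2 ^ k) (lattice_sum \<psi> k A)"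
      unfolding lattice_sum_def[abs_def] by (intro deriv_bounded_sum[OF A]) simp
    then show "deriv_bounded K (\<lambda>x. C * N) (2 ^ k) (lattice_sum \<psi> k A)"
    proof (rule deriv_bounded_mono)
      fix x :: "real ^ 'n"
      let ?M = "{m. norm (lattice_point m - 2 ^ k *\<^sub>R x) \<le> sqrt (real CARD('n))}"
      have "(\<Sum>l\<in>A. ?C l x) \<le> (\<Sum>l\<in>A \<inter> ?M. C)"
      proof -
        have "(\<Sum>l\<in>A. ?C l x) = (\<Sum>l\<in>A \<inter> ?M. ?C l x)"
          using sub by (intro sum.mono_neutral_right A)
            (auto simp: indicator_def norm_minus_commute subset_iff)
        also have "\<dots> \<le> (\<Sum>l\<in>A \<inter> ?M. C)"
          using C by (intro sum_mono) (auto simp: indicator_def)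
        finally show ?thesis .
      qed
      also have "\<dots> = C * card (A \<inter> ?M)" by simp
      also have "card (A \<inter> ?M) \<le> card ?M"
        by (intro card_mono finite_lattice_cball) auto
      also have "\<dots> \<le> N" by (rule N)
      finally show "(\<Sum>l\<in>A. ?C l x) \<le> C * N" using C by (simp add: mult_left_mono)
    qed (use C in auto)
  qed
qed

end

section \<open>Counting cells along an \<open>h\<close>-set\<close>

lemma sum_measure_le_overlap:
  assumes "finite_measure M" "finite I" "\<And>i. i \<in> I \<Longrightarrow> A i \<in> sets M" "B \<in> sets M"
    and "\<And>i. i \<in> I \<Longrightarrow> A i \<subseteq> B" "\<And>x. x \<in> B \<Longrightarrow> card {i \<in> I. x \<in> A i} \<le> N"
  shows "(\<Sum>i\<in>I. measure M (A i)) \<le> real N * measure M B"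
proof -
  interpret finite_measure M by fact
  have "(\<Sum>i\<in>I. measure M (A i)) = (\<integral>x. (\<Sum>i\<in>I. indicator (A i) x) \<partial>M)"
    using assms(2,3) by (subst Bochner_Integration.integral_sum) (auto simp: less_top[symmetric])
  also have "\<dots> \<le> (\<integral>x. real N * indicator B x \<partial>M)"
  proof (rule integral_mono)
    show "integrable M (\<lambda>x. \<Sum>i\<in>I. indicator (A i) x :: real)"
      using assms(2,3) by (intro Bochner_Integration.integrable_sum) (auto simp: less_top[symmetric])
    show "integrable M (\<lambda>x. real N * indicator B x)"
      using assms(4) by (auto simp: less_top[symmetric])
    fix x
    have "(\<Sum>i\<in>I. indicator (A i) x :: real) = real (card {i \<in> I. x \<in> A i})"
      using assms(2) by (simp add: indicator_def sum.If_cases Int_def)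
    also have "\<dots> \<le> real N * indicator B x"
    proof (cases "x \<in> B")
      case False
      then have "{i \<in> I. x \<in> A i} = {}" using assms(5) by auto
      then have "card {i \<in> I. x \<in> A i} = 0" by (simp only: card.empty)
      with False show ?thesis by simp
    qed (use assms(6) in simp)
    finally show "(\<Sum>i\<in>I. indicator (A i) x :: real) \<le> real N * indicator B x" .
  qed
  also have "\<dots> = real N * measure M B"
    using assms(4) by simp
  finally show ?thesis .
qed

text \<open>
  The picture is scaled by \<open>2\<^bsup>j\<^esup>\<close>: these are the cells of scale \<open>2\<^bsup>-k\<^esup>\<close>, within \<open>R\<close> cell sizes of the
  set \<open>2\<^bsup>j\<^esup> \<Gamma>\<close>, that belong to points of this set at distance at most \<open>r\<close> from \<open>b\<close>.
\<close>

definition boundary_cells ::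
  "(real ^ 'n) set \<Rightarrow> real \<Rightarrow> real \<Rightarrow> nat \<Rightarrow> nat \<Rightarrow> real ^ 'n \<Rightarrow> (int ^ 'n) set" where
  "boundary_cells \<Gamma> r R j k b =
     {m. \<exists>\<gamma>\<in>\<Gamma>. norm (2 ^ j *\<^sub>R \<gamma> - b) \<le> r \<and> norm (2 ^ (j + k) *\<^sub>R \<gamma> - lattice_point m) \<le> R}"

lemma dyadic_powr: "2 powr (- real j) = 1 / 2 ^ j"
  by (simp add: powr_minus powr_realpow divide_simps)

text \<open>
  The geometric core. Each cell is witnessed by a point of \<open>\<Gamma>\<close>, and the ball of radius \<open>2\<^bsup>-j-k\<^esup>\<close> around
  it has measure at least \<open>c1 h(2\<^bsup>-j-k\<^esup>)\<close>. These balls overlap boundedly often, since a point can lie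
  only in balls of the boundedly many cells close to it. The witnesses of all cells are distributed
  over a fixed number of pieces of diameter at most \<open>2\<^bsup>-j\<^esup> / 2\<close>, and the balls of one
  piece lie in a single ball of radius \<open>2\<^bsup>-j\<^esup>\<close> centred on \<open>\<Gamma>\<close>, of measure at most \<open>c2 h(2\<^bsup>-j\<^esup>)\<close>. For this
  inclusion the small radius must be at most half the large one, that is \<open>k \<ge> 1\<close>.
\<close>

lemma card_boundary_cells_le:
  fixes \<Gamma> :: "(real ^ 'n) set"
  assumes "h_set h \<Gamma>"
  obtains C where "0 < C"
    "\<And>j k b. 1 \<le> k \<Longrightarrow> finite (boundary_cells \<Gamma> r R j k b) \<and>
       real (card (boundary_cells \<Gamma> r R j k b)) \<le>
         C * (h (2 powr (- real j)) / h (2 powr (- real (j + k))))"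
proof -
  obtain \<mu> :: "(real ^ 'n) measure" and c1 c2 where
    \<mu>: "sets \<mu> = sets borel" "finite_measure \<mu>" and c: "0 < c1" "0 < c2" and
    est: "\<And>\<gamma> s. \<gamma> \<in> \<Gamma> \<Longrightarrow> s \<in> {0<..1} \<Longrightarrow>
      c1 * h s \<le> measure \<mu> (ball \<gamma> s) \<and> measure \<mu> (ball \<gamma> s) \<le> c2 * h s"
    using assms unfolding h_set_def by blast
  have hpos: "\<And>s. s \<in> {0<..1} \<Longrightarrow> 0 < h s"
    using assms by (simp add: h_set_def)
  obtain N :: nat where N: "\<And>y :: real ^ 'n. card {m :: int ^ 'n. norm (lattice_point m - y) \<le> R + 1} \<le> N"
    using card_lattice_cball_bounded[of "R + 1"] by blast
  have "compact (cball 0 r :: (real ^ 'n) set)" by simp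
  then obtain Z where Z: "finite Z" "cball 0 r \<subseteq> (\<Union>z\<in>Z. ball z (1 / 4 :: real) :: (real ^ 'n) set)"
  proof (rule compactE_image[of _ UNIV "\<lambda>z. ball z (1 / 4)"])
    have "x \<in> ball x (1 / 4)" for x :: "real ^ 'n" by simp
    then show "cball 0 r \<subseteq> (\<Union>z. ball z (1 / 4 :: real) :: (real ^ 'n) set)" by blast
  qed auto
  show thesis
  proof
    show "0 < (real (card Z) + 1) * (real N + 1) * c2 / c1" using c by simp
    fix j k :: nat and b :: "real ^ 'n" assume k: "1 \<le> k"
    let ?\<rho> = "1 / 2 ^ (j + k) :: real" and ?\<sigma> = "1 / 2 ^ j :: real"
    define q where "q = h ?\<sigma> / h ?\<rho>"
    have sc: "?\<rho> \<in> {0<..1}" "?\<sigma> \<in> {0<..1}" by (auto simp: divide_le_eq)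
    have "2 ^ 1 \<le> (2 ^ k :: real)" using k by (intro power_increasing) auto
    then have half: "?\<rho> \<le> ?\<sigma> / 2" by (simp add: power_add field_simps)
    \<comment> \<open>After scaling, the points of one piece differ by less than 1/2.\<close>
    define G where "G z = {\<gamma> \<in> \<Gamma>. norm (2 ^ j *\<^sub>R \<gamma> - b - z) < 1 / 4}" for z
    define X where "X z = {m :: int ^ 'n. \<exists>\<gamma>\<in>G z. norm (2 ^ (j + k) *\<^sub>R \<gamma> - lattice_point m) \<le> R}" for z
    have cover: "boundary_cells \<Gamma> r R j k b \<subseteq> (\<Union>z\<in>Z. X z)"
    proof
      fix m assume "m \<in> boundary_cells \<Gamma> r R j k b"
      then obtain \<gamma> where \<gamma>: "\<gamma> \<in> \<Gamma>" "2 ^ j *\<^sub>R \<gamma> - b \<in> cball 0 r"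
        "norm (2 ^ (j + k) *\<^sub>R \<gamma> - lattice_point m) \<le> R"
        unfolding boundary_cells_def by auto
      then obtain z where "z \<in> Z" "2 ^ j *\<^sub>R \<gamma> - b \<in> ball z (1 / 4)" using Z(2) by blast
      with \<gamma> show "m \<in> (\<Union>z\<in>Z. X z)"
        by (auto simp: X_def G_def dist_norm norm_minus_commute intro!: bexI[of _ z])
    qed
    have Xz: "finite (X z) \<and> real (card (X z)) \<le> real N * (c2 / c1) * q" for z
    proof (cases "G z = {}")
      case True
      then have "X z = {}" by (simp add: X_def)
      then show ?thesis using c hpos[OF sc(1)] hpos[OF sc(2)] by (simp add: q_def)
    next
      case False
      then obtain \<gamma>0 where \<gamma>0: "\<gamma>0 \<in> G z" by auto
      have near: "dist \<gamma>0 \<gamma> \<le> ?\<sigma> / 2" if "\<gamma> \<in> G z" for \<gamma>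
      proof -
        have "norm (2 ^ j *\<^sub>R \<gamma> - 2 ^ j *\<^sub>R \<gamma>0) \<le> 1 / 2"
          using norm_triangle_ineq4[of "2 ^ j *\<^sub>R \<gamma> - b - z" "2 ^ j *\<^sub>R \<gamma>0 - b - z"] that \<gamma>0
          by (simp add: G_def)
        then have "2 ^ j * dist \<gamma>0 \<gamma> \<le> 1 / 2"
          by (simp add: dist_norm norm_minus_commute flip: scaleR_diff_right)
        then show ?thesis by (simp add: field_simps)
      qed
      have "norm (lattice_point m - 2 ^ (j + k) *\<^sub>R \<gamma>0) \<le> R + 2 ^ (j + k) * (?\<sigma> / 2)" if "m \<in> X z" for m
      proof -
        obtain \<gamma> where \<gamma>: "\<gamma> \<in> G z" "norm (2 ^ (j + k) *\<^sub>R \<gamma> - lattice_point m) \<le> R"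
          using \<open>m \<in> X z\<close> by (auto simp: X_def)
        have "norm (2 ^ (j + k) *\<^sub>R \<gamma> - 2 ^ (j + k) *\<^sub>R \<gamma>0) = 2 ^ (j + k) * dist \<gamma>0 \<gamma>"
          by (simp add: dist_norm norm_minus_commute flip: scaleR_diff_right)
        also have "\<dots> \<le> 2 ^ (j + k) * (?\<sigma> / 2)"
          by (intro mult_left_mono near \<gamma>) simp
        finally show ?thesis
          using norm_triangle_ineq4[of "2 ^ (j + k) *\<^sub>R \<gamma> - 2 ^ (j + k) *\<^sub>R \<gamma>0"
              "2 ^ (j + k) *\<^sub>R \<gamma> - lattice_point m"] \<gamma>(2) by simp
      qed
      then have fin: "finite (X z)"
        by (intro finite_subset[OF _ finite_lattice_cball]) auto
      have "\<forall>m\<in>X z. \<exists>\<gamma>. \<gamma> \<in> G z \<and> norm (2 ^ (j + k) *\<^sub>R \<gamma> - lattice_point m) \<le> R"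
        by (auto simp: X_def)
      then obtain g where g: "\<And>m. m \<in> X z \<Longrightarrow> g m \<in> G z"
        "\<And>m. m \<in> X z \<Longrightarrow> norm (2 ^ (j + k) *\<^sub>R g m - lattice_point m) \<le> R"
        by metis
      have "real (card (X z)) * (c1 * h ?\<rho>) = (\<Sum>m\<in>X z. c1 * h ?\<rho>)" by simp
      also have "\<dots> \<le> (\<Sum>m\<in>X z. measure \<mu> (ball (g m) ?\<rho>))"
        using g(1) est sc(1) by (intro sum_mono) (auto simp: G_def)
      also have "\<dots> \<le> real N * measure \<mu> (ball \<gamma>0 ?\<sigma>)"
      proof (rule sum_measure_le_overlap)
        show "ball (g m) ?\<rho> \<subseteq> ball \<gamma>0 ?\<sigma>" if "m \<in> X z" for m
        proof
          fix y assume "y \<in> ball (g m) ?\<rho>"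
          then have "dist \<gamma>0 y < ?\<sigma> / 2 + ?\<rho>"
            using near[OF g(1)[OF that]] dist_triangle[of \<gamma>0 y "g m"] by simp
          with half show "y \<in> ball \<gamma>0 ?\<sigma>" by simp
        qed
        fix x
        have "norm (lattice_point m - 2 ^ (j + k) *\<^sub>R x) \<le> R + 1"
          if "m \<in> X z" "x \<in> ball (g m) ?\<rho>" for m
        proof -
          have "norm (2 ^ (j + k) *\<^sub>R g m - 2 ^ (j + k) *\<^sub>R x) = 2 ^ (j + k) * dist (g m) x"
            by (simp add: dist_norm flip: scaleR_diff_right)
          also have "\<dots> \<le> 2 ^ (j + k) * ?\<rho>"
            using that by (intro mult_left_mono) auto
          finally show ?thesis
            using g(2)[OF that(1)]
              norm_triangle_ineq4[of "2 ^ (j + k) *\<^sub>R g m - 2 ^ (j + k) *\<^sub>R x"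
                "2 ^ (j + k) *\<^sub>R g m - lattice_point m"] by simp
        qed
        then have "card {m \<in> X z. x \<in> ball (g m) ?\<rho>} \<le>
            card {m :: int ^ 'n. norm (lattice_point m - 2 ^ (j + k) *\<^sub>R x) \<le> R + 1}"
          by (intro card_mono finite_lattice_cball) auto
        also have "\<dots> \<le> N" by (rule N)
        finally show "card {m \<in> X z. x \<in> ball (g m) ?\<rho>} \<le> N" .
      qed (use \<mu> fin in auto)
      also have "\<dots> \<le> real N * (c2 * h ?\<sigma>)"
        using est[of \<gamma>0 ?\<sigma>] \<gamma>0 sc(2) by (intro mult_left_mono) (auto simp: G_def)
      finally have "real (card (X z)) \<le> real N * (c2 / c1) * q"
        using c hpos[OF sc(1)] by (simp add: q_def field_simps)
      with fin show ?thesis by blast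
    qed
    have q0: "0 \<le> q" using hpos[OF sc(1)] hpos[OF sc(2)] by (simp add: q_def)
    have finU: "finite (\<Union>z\<in>Z. X z)" using Z(1) Xz by blast
    then have fin: "finite (boundary_cells \<Gamma> r R j k b)" by (rule finite_subset[OF cover])
    have "card (boundary_cells \<Gamma> r R j k b) \<le> card (\<Union>z\<in>Z. X z)"
      by (intro card_mono finU cover)
    also have "\<dots> \<le> (\<Sum>z\<in>Z. card (X z))" by (rule card_UN_le[OF Z(1)])
    finally have "real (card (boundary_cells \<Gamma> r R j k b)) \<le> (\<Sum>z\<in>Z. real (card (X z)))"
      by (simp flip: of_nat_sum)
    also have "\<dots> \<le> (\<Sum>z\<in>Z. real N * (c2 / c1) * q)" by (intro sum_mono) (use Xz in blast)
    also have "\<dots> = real (card Z) * real N * (c2 / c1 * q)" by simp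
    also have "\<dots> \<le> (real (card Z) + 1) * (real N + 1) * (c2 / c1 * q)"
      using c q0 by (intro mult_right_mono mult_mono) auto
    finally show "finite (boundary_cells \<Gamma> r R j k b) \<and> real (card (boundary_cells \<Gamma> r R j k b)) \<le>
         (real (card Z) + 1) * (real N + 1) * c2 / c1 * (h (2 powr (- real j)) / h (2 powr (- real (j + k))))"
      using fin by (simp only: dyadic_powr q_def) simp
  qed
qed

text \<open>
  A ball is connected, so it meets the frontier of every set that it enters without being contained
  in it.
\<close>

lemma frontier_near_inner_layer:
  fixes \<Omega> :: "(real ^ 'n) set"
  assumes "x \<in> inner_layer {x. (1 / 2 ^ j) *\<^sub>R x \<in> \<Omega>} r"
  obtains \<gamma> where "\<gamma> \<in> frontier \<Omega>" "norm (2 ^ j *\<^sub>R \<gamma> - x) \<le> r"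
proof -
  obtain z where "z \<in> cball x r" "z \<notin> {x. (1 / 2 ^ j) *\<^sub>R x \<in> \<Omega>}" "x \<in> {x. (1 / 2 ^ j) *\<^sub>R x \<in> \<Omega>}"
    using assms unfolding inner_layer_def by blast
  then have z: "dist x z \<le> r" "(1 / 2 ^ j) *\<^sub>R x \<in> \<Omega>" "(1 / 2 ^ j) *\<^sub>R z \<notin> \<Omega>"
    by simp_all
  let ?c = "cball ((1 / 2 ^ j) *\<^sub>R x) (r / 2 ^ j)"
  have "dist ((1 / 2 ^ j) *\<^sub>R x) ((1 / 2 ^ j) *\<^sub>R z) = dist x z / 2 ^ j"
    by (simp add: dist_norm flip: scaleR_diff_right)
  then have "(1 / 2 ^ j) *\<^sub>R z \<in> ?c" using z(1) by (simp add: divide_right_mono)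
  moreover have "(1 / 2 ^ j) *\<^sub>R x \<in> ?c"
    using z(1) zero_le_dist[of x z] by (simp del: zero_le_dist)
  moreover have "connected ?c" by (simp add: convex_connected)
  ultimately obtain \<gamma> where \<gamma>: "\<gamma> \<in> ?c" "\<gamma> \<in> frontier \<Omega>"
    using connected_Int_frontier[of ?c \<Omega>] z(2,3) by blast
  then have "norm (2 ^ j *\<^sub>R \<gamma> - x) \<le> r"
    using rescale_dist[of j x \<gamma>] by (simp add: divide_le_cancel)
  with \<gamma>(2) show thesis by (rule that)
qed

section \<open>Quasi-norms of sequences and functions\<close>

lemma epowr_ennreal: "0 \<le> a \<Longrightarrow> epowr (ennreal a) r = ennreal (a powr r)"
  by (simp add: epowr_def)

lemma epowr_mono:
  assumes "x \<le> y" "0 \<le> r"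
  shows "epowr x r \<le> epowr y r"
proof (cases "y = \<infinity>")
  case False
  then have "x \<noteq> \<infinity>" using assms(1) by (auto simp: top_unique)
  moreover have "enn2real x \<le> enn2real y"
    using assms(1) False by (intro enn2real_mono) (auto simp: less_top)
  ultimately show ?thesis
    using False assms(2) by (auto simp: epowr_def intro!: ennreal_leI powr_mono2)
qed (simp add: epowr_def)

lemma epowr_less_top: "x < \<infinity> \<Longrightarrow> epowr x r < \<infinity>"
  by (simp add: epowr_def)

lemma epowr_inverse: "0 < r \<Longrightarrow> epowr (epowr x r) (1 / r) = x"
  by (cases x) (auto simp: epowr_def powr_powr)

lemma infsum_eq_suminf_ennreal:
  fixes f :: "nat \<Rightarrow> ennreal"
  shows "(\<Sum>\<^sub>\<infinity>k. f k) = (\<Sum>k. f k)"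
proof -
  have "(f has_sum (\<Sum>\<^sub>\<infinity>k. f k)) UNIV" by (intro has_sum_infsum nonneg_summable_on_complete) simp
  then show ?thesis using has_sum_imp_sums sums_unique by blast
qed

lemma enn2real_index_pos: "0 < q \<Longrightarrow> q \<noteq> \<infinity> \<Longrightarrow> 0 < enn2real q"
  by (cases q) (auto simp: zero_less_iff_neq_zero)

lemma le_seq_qnorm:
  fixes u :: "nat \<Rightarrow> ennreal"
  assumes "0 < q"
  shows "u i \<le> seq_qnorm q u"
proof (cases "q = \<infinity>")
  case True
  then show ?thesis by (simp add: seq_qnorm_def SUP_upper)
next
  case False
  define e where "e = enn2real q"
  have e: "0 < e" using assms False by (simp add: e_def enn2real_index_pos)
  have "epowr (u i) e \<le> (\<Sum>k. epowr (u k) e)"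
    using sum_le_suminf[OF summableI, of "{i}" "\<lambda>k. epowr (u k) e"] by simp
  then have "epowr (epowr (u i) e) (1 / e) \<le> epowr (\<Sum>k. epowr (u k) e) (1 / e)"
    by (rule epowr_mono) (use e in simp)
  then show ?thesis
    using False e by (simp add: seq_qnorm_def infsum_eq_suminf_ennreal epowr_inverse flip: e_def)
qed

lemma seq_qnorm_finite_const:
  assumes "finite M" "0 < p" "0 \<le> \<Lambda>"
  shows "seq_qnorm (ennreal p) (\<lambda>m. ennreal (cmod (if m \<in> M then complex_of_real \<Lambda> else 0)))
    = ennreal (\<Lambda> * real (card M) powr (1 / p))"
proof -
  let ?f = "\<lambda>m. epowr (ennreal (cmod (if m \<in> M then complex_of_real \<Lambda> else 0))) p"
  have "(\<Sum>\<^sub>\<infinity>m. ?f m) = (\<Sum>\<^sub>\<infinity>m\<in>M. ennreal (\<Lambda> powr p))"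
    by (rule infsum_cong_neutral) (use assms in \<open>auto simp: epowr_ennreal epowr_def\<close>)
  also have "\<dots> = ennreal (real (card M) * \<Lambda> powr p)"
    using assms by (simp add: ennreal_mult ennreal_of_nat_eq_real_of_nat)
  finally have "seq_qnorm (ennreal p) (\<lambda>m. ennreal (cmod (if m \<in> M then complex_of_real \<Lambda> else 0)))
      = ennreal ((real (card M) * \<Lambda> powr p) powr (1 / p))"
    using assms by (simp add: seq_qnorm_def epowr_ennreal)
  also have "(real (card M) * \<Lambda> powr p) powr (1 / p) = \<Lambda> * real (card M) powr (1 / p)"
    using assms by (simp add: powr_mult powr_powr)
  finally show ?thesis .
qed

text \<open>
  Up to constants, the proportion of the volume of a ball of radius \<open>2\<^bsup>-j\<^esup>\<close> centred on the \<open>h\<close>-set that is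
  filled by the \<open>2\<^bsup>-j-k\<^esup>\<close>-neighbourhood of the set.
\<close>

definition h_ratio :: "nat \<Rightarrow> (real \<Rightarrow> real) \<Rightarrow> nat \<Rightarrow> nat \<Rightarrow> real" where
  "h_ratio n h j k =
     h (2 powr (- real j)) / h (2 powr (- real (j + k))) * 2 powr (- real (k * n))"

text \<open>
  The hypothesis on \<open>h\<close> says that the weighted sequence \<open>2\<^bsup>k\<sigma>\<^esup> (ratio j k)\<^bsup>1/p\<^esup>\<close>, \<open>k \<ge> 0\<close>, has a quasi-norm
  in the sequence space with index \<open>q\<close> that is bounded uniformly in \<open>j\<close>. In this form it is applied to
  the level-by-level quasi-norms of atomic coefficients.
\<close>

lemma h_condition_seq_qnorm:
  assumes cond: "h_condition n h \<sigma> p q" and "0 < p" "0 < q" "0 \<le> c"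
    and nonneg: "\<And>j k. 0 \<le> h_ratio n h j k"
  obtains B where "B < \<infinity>"
    "\<And>j u. (\<And>k. u k \<le> ennreal (c * (2 powr (real k * \<sigma>) * h_ratio n h j k powr (1 / p))))
       \<Longrightarrow> seq_qnorm q u \<le> B"
proof (cases "q = \<infinity>")
  case True
  define S where "S = (SUP j. SUP k. ennreal (2 powr (real k * \<sigma>) * h_ratio n h j k powr (1 / p)))"
  have S: "S < \<infinity>" using cond True by (simp add: h_condition_def S_def h_ratio_def)
  show thesis
  proof
    show "ennreal c * S < \<infinity>" using S by (simp add: ennreal_mult_less_top)
    fix j and u :: "nat \<Rightarrow> ennreal"
    assume u: "\<And>k. u k \<le> ennreal (c * (2 powr (real k * \<sigma>) * h_ratio n h j k powr (1 / p)))"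
    have "u k \<le> ennreal c * S" for k
    proof -
      have "u k \<le> ennreal c * ennreal (2 powr (real k * \<sigma>) * h_ratio n h j k powr (1 / p))"
        using u[of k] \<open>0 \<le> c\<close> by (simp add: ennreal_mult')
      also have "\<dots> \<le> ennreal c * S"
        unfolding S_def by (intro mult_left_mono SUP_upper2[of j] SUP_upper2[of k]) auto
      finally show ?thesis .
    qed
    then show "seq_qnorm q u \<le> ennreal c * S"
      using True by (simp add: seq_qnorm_def SUP_le_iff)
  qed
next
  case False
  define e where "e = enn2real q"
  have e: "0 < e" using assms False by (simp add: e_def enn2real_index_pos)
  define t where "t j k = ennreal (2 powr (real k * \<sigma> * e) * h_ratio n h j k powr (e / p))" for j k
  define S where "S = (SUP j. \<Sum>k. t j k)"
  have S: "S < \<infinity>" 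
    using cond unfolding h_condition_def Let_def if_not_P[OF False] S_def t_def e_def h_ratio_def .
  show thesis
  proof
    show "epowr (ennreal (c powr e) * S) (1 / e) < \<infinity>"
      using S by (intro epowr_less_top) (simp add: ennreal_mult_less_top)
    fix j and u :: "nat \<Rightarrow> ennreal"
    assume u: "\<And>k. u k \<le> ennreal (c * (2 powr (real k * \<sigma>) * h_ratio n h j k powr (1 / p)))"
    have "epowr (u k) e \<le> ennreal (c powr e) * t j k" for k
    proof -
      have "epowr (u k) e \<le>
          epowr (ennreal (c * (2 powr (real k * \<sigma>) * h_ratio n h j k powr (1 / p)))) e"
        using e by (intro epowr_mono u) simp
      also have "\<dots> = ennreal ((c * (2 powr (real k * \<sigma>) * h_ratio n h j k powr (1 / p))) powr e)"
        using \<open>0 \<le> c\<close> by (intro epowr_ennreal) simp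
      also have "(c * (2 powr (real k * \<sigma>) * h_ratio n h j k powr (1 / p))) powr e =
          c powr e * (2 powr (real k * \<sigma> * e) * h_ratio n h j k powr (e / p))"
        using \<open>0 \<le> c\<close> nonneg by (simp add: powr_mult powr_powr)
      finally show ?thesis by (simp add: t_def ennreal_mult')
    qed
    then have "(\<Sum>k. epowr (u k) e) \<le> (\<Sum>k. ennreal (c powr e) * t j k)"
      by (intro suminf_le summableI) auto
    also have "\<dots> = ennreal (c powr e) * (\<Sum>k. t j k)" by simp
    also have "\<dots> \<le> ennreal (c powr e) * S"
      unfolding S_def by (intro mult_left_mono SUP_upper) auto
    finally have "epowr (\<Sum>k. epowr (u k) e) (1 / e) \<le> epowr (ennreal (c powr e) * S) (1 / e)"
      by (rule epowr_mono) (use e in simp)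
    then show "seq_qnorm q u \<le> epowr (ennreal (c powr e) * S) (1 / e)"
      using False by (simp add: seq_qnorm_def infsum_eq_suminf_ennreal e_def)
  qed
qed

text \<open>
  The uniform bound on single terms gives the decay in \<open>k\<close> of the volume of the boundary layers, hence
  the convergence of the atomic series.
\<close>

lemma h_condition_bounded:
  assumes cond: "h_condition n h \<sigma> p q" and "0 < p" "0 < q"
    and nonneg: "\<And>j k. 0 \<le> h_ratio n h j k"
  obtains B where "0 \<le> B" "\<And>j k. 2 powr (real k * \<sigma>) * h_ratio n h j k powr (1 / p) \<le> B"
proof -
  obtain B where B: "B < \<infinity>"
    "\<And>j u. (\<And>k. u k \<le> ennreal (1 * (2 powr (real k * \<sigma>) * h_ratio n h j k powr (1 / p))))
       \<Longrightarrow> seq_qnorm q u \<le> B"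
    using h_condition_seq_qnorm[OF assms(1-3) zero_le_one nonneg] by blast
  show thesis
  proof (rule that[of "enn2real B"])
    fix j k
    let ?w = "\<lambda>k. 2 powr (real k * \<sigma>) * h_ratio n h j k powr (1 / p)"
    have "ennreal (?w k) \<le> seq_qnorm q (\<lambda>k. ennreal (?w k))"
      using le_seq_qnorm[OF \<open>0 < q\<close>, of "\<lambda>k. ennreal (?w k)" k] by simp
    also have "\<dots> \<le> B" by (rule B(2)[of _ j]) simp
    finally show "?w k \<le> enn2real B"
      using B(1) by (cases B) (auto simp: ennreal_le_iff)
  qed simp
qed

lemma Lp_qnorm_le_indicator:
  assumes "0 < p" "F \<in> sets lebesgue" "\<And>x. cmod (f x) \<le> indicator F x"
  shows "Lp_qnorm (ennreal p) f \<le> epowr (emeasure lebesgue F) (1 / p)"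
proof -
  have "(\<integral>\<^sup>+x. ennreal (cmod (f x) powr p) \<partial>lebesgue) \<le> (\<integral>\<^sup>+x. indicator F x \<partial>lebesgue)"
  proof (rule nn_integral_mono)
    fix x
    have "cmod (f x) powr p \<le> (indicator F x :: real) powr p"
      using assms by (intro powr_mono2) auto
    also have "\<dots> = indicator F x" by (simp add: indicator_def)
    finally have "ennreal (cmod (f x) powr p) \<le> ennreal (indicator F x)" by (rule ennreal_leI)
    then show "ennreal (cmod (f x) powr p) \<le> indicator F x" by (simp add: ennreal_indicator)
  qed
  also have "\<dots> = emeasure lebesgue F" using assms(2) by simp
  finally show ?thesis
    using assms(1) by (simp add: Lp_qnorm_def epowr_mono)
qed

lemma dcube_eq_cbox:
  "dcube d k m = cbox (\<chi> i. lattice_point m $ i / 2 ^ k - d / 2 ^ k) (\<chi> i. lattice_point m $ i / 2 ^ k + d / 2 ^ k)"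
  by (auto simp: dcube_def dyadic_powr mem_box_cart abs_le_iff algebra_simps)

lemma closed_dcube: "closed (dcube d k m)"
  unfolding dcube_eq_cbox by (rule closed_cbox)

lemma dcube_lebesgue: "dcube d k m \<in> sets lebesgue"
  by (simp add: dcube_eq_cbox)

lemma emeasure_dcube:
  assumes "0 \<le> d"
  shows "emeasure lebesgue (dcube d k (m :: int ^ 'n)) = ennreal ((2 * d / 2 ^ k) ^ CARD('n))"
proof -
  let ?a = "(\<chi> i. lattice_point m $ i / 2 ^ k - d / 2 ^ k) :: real ^ 'n"
  let ?b = "(\<chi> i. lattice_point m $ i / 2 ^ k + d / 2 ^ k) :: real ^ 'n"
  have "?a $ i \<le> ?b $ i" for i
    using assms by (simp add: add_increasing2)
  then have "cbox ?a ?b \<noteq> {}" by (simp add: interval_ne_empty_cart)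
  then have "measure lborel (cbox ?a ?b) = (\<Prod>i\<in>(UNIV::'n set). ?b $ i - ?a $ i)" by (rule content_cbox_cart)
  also have "\<dots> = (\<Prod>i\<in>(UNIV::'n set). 2 * d / 2 ^ k)" by (intro prod.cong) auto
  finally have "measure lborel (cbox ?a ?b) = (2 * d / 2 ^ k) ^ CARD('n)" by simp
  moreover have "emeasure lborel (cbox ?a ?b) = ennreal (measure lborel (cbox ?a ?b))"
    by (intro emeasure_eq_ennreal_measure) (use emeasure_lborel_cbox_finite[of ?a ?b] in auto)
  ultimately show ?thesis by (simp add: dcube_eq_cbox)
qed

section \<open>Atoms for a smoothly cut off characteristic function\<close>

definition layer_cells :: "(real ^ 'n) set \<Rightarrow> int ^ 'n \<Rightarrow> real \<Rightarrow> nat \<Rightarrow> (int ^ 'n) set" where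
  "layer_cells W l R k =
     {m. \<exists>x\<in>inner_layer W (2 * sqrt (real CARD('n)) / 2 ^ k).
           norm (x - lattice_point l) \<le> sqrt (real CARD('n)) \<and>
           norm (2 ^ k *\<^sub>R x - lattice_point m) \<le> R}"

lemma inner_layer_mono: "r \<le> s \<Longrightarrow> inner_layer W r \<subseteq> inner_layer W s"
  unfolding inner_layer_def using subset_cball[of r s] by blast

lemma is_atomI:
  assumes "deriv_bounded K (\<lambda>x. c) M a" "\<And>x. a x \<noteq> 0 \<Longrightarrow> x \<in> dcube d k m"
    and "\<And>i. i \<le> K \<Longrightarrow> c * M ^ i \<le> (2 ^ k) ^ i"
  shows "is_atom d K k m a"
proof -
  have "fun_support a \<subseteq> dcube d k m"
    unfolding fun_support_def using assms(2) by (intro closure_minimal closed_dcube) auto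
  moreover have "2 powr (real i * real k) = ((2::real) ^ k) ^ i" for i
    by (simp add: powr_realpow flip: of_nat_mult power_mult mult.commute)
  ultimately show ?thesis
    using assms(1,3) unfolding is_atom_def deriv_bounded_def by (fastforce intro: order_trans)
qed

context smooth_resolution
begin

text \<open>
  A product of three lattice sums whose scales are 1, \<open>2\<^bsup>k+1\<^esup>\<close> and \<open>2\<^bsup>k+s\<^esup>\<close>. The sum of these scales is
  at most \<open>2\<^bsup>k\<^esup> (3 + 2\<^bsup>s\<^esup>)\<close>, so only the factor \<open>(3 + 2\<^bsup>s\<^esup>)\<^bsup>K\<^esup>\<close> and the constants have to be normalised
  away by \<open>\<Lambda>\<close> to obtain the derivative bounds of atoms.
\<close>

lemma localised_difference_deriv_bounded:
  obtains \<Lambda> where "0 < \<Lambda>"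
    "\<And>k l A A' A''. finite A \<Longrightarrow> finite A' \<Longrightarrow> finite A'' \<Longrightarrow>
       \<exists>c M. deriv_bounded K (\<lambda>x. c) M (\<lambda>x. complex_of_real (\<psi> (x - lattice_point l) *
           (lattice_sum \<psi> (Suc k) A x - lattice_sum \<psi> k A' x) * lattice_sum \<psi> (k + s) A'' x / \<Lambda>)) \<and>
         (\<forall>i\<le>K. c * M ^ i \<le> (2 ^ k) ^ i)"
proof -
  obtain B where B: "0 \<le> B"
    "\<And>k A. finite A \<Longrightarrow> deriv_bounded K (\<lambda>x. B) (2 ^ k) (lattice_sum \<psi> k A)"
    using lattice_sum_deriv_bounded[of K] by blast
  define E where "E = (3 + 2 ^ s :: real)"
  define \<Lambda> where "\<Lambda> = B * (B + 1 * B) * B * E ^ K + 1"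
  have E1: "1 \<le> E" by (simp add: E_def)
  have \<Lambda>: "0 < \<Lambda>" using B(1) E1 by (simp add: \<Lambda>_def add_nonneg_pos)
  show thesis
  proof
    fix k and l :: "int ^ 'n" and A A' A'' :: "(int ^ 'n) set"
    assume fin: "finite A" "finite A'" "finite A''"
    have 0: "deriv_bounded K (\<lambda>x. B) 1 (\<lambda>x. \<psi> (x - lattice_point l))"
      using B(2)[of "{l}" 0] by (simp add: lattice_sum_def[abs_def])
    have 1: "deriv_bounded K (\<lambda>x. B) (2 ^ Suc k) (lattice_sum \<psi> (Suc k) A)"
      by (rule B(2)) (rule fin)
    have "deriv_bounded K (\<lambda>x. B) (2 ^ Suc k) (lattice_sum \<psi> k A')"
      by (rule deriv_bounded_mono[OF B(2)]) (use fin B(1) in auto)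
    then have 2: "deriv_bounded K (\<lambda>x. 1 * B) (2 ^ Suc k) (\<lambda>x. - lattice_sum \<psi> k A' x)"
      by (intro deriv_bounded_linear bounded_linear_minus bounded_linear_ident) auto
    have 3: "deriv_bounded K (\<lambda>x. B) (2 ^ (k + s)) (lattice_sum \<psi> (k + s) A'')"
      by (rule B(2)) (rule fin)
    let ?c = "1 / \<Lambda> * (B * (B + 1 * B) * B)" and ?M = "1 + 2 ^ Suc k + 2 ^ (k + s) :: real"
    have "deriv_bounded K (\<lambda>x. ?c) ?M (\<lambda>x. complex_of_real ((\<psi> (x - lattice_point l) *
        (lattice_sum \<psi> (Suc k) A x + - lattice_sum \<psi> k A' x) * lattice_sum \<psi> (k + s) A'' x) / \<Lambda>))"
    proof (rule deriv_bounded_linear[where L = "\<lambda>y. complex_of_real (y / \<Lambda>)"])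
      show "bounded_linear (\<lambda>y. complex_of_real (y / \<Lambda>))"
        using bounded_linear_compose[OF bounded_linear_of_real bounded_linear_divide] .
      show "norm (complex_of_real (y / \<Lambda>)) \<le> 1 / \<Lambda> * norm y" for y
        unfolding norm_of_real using \<Lambda> by (simp add: abs_divide)
    qed (use \<Lambda> in \<open>simp, intro deriv_bounded_mult deriv_bounded_add 0 1 2 3\<close>)
    moreover have "?c * ?M ^ i \<le> (2 ^ k) ^ i" if "i \<le> K" for i
    proof -
      have "?M \<le> 2 ^ k * E"
        by (simp add: E_def power_add algebra_simps)
      then have "?M ^ i \<le> (2 ^ k * E) ^ i" by (intro power_mono) auto
      also have "\<dots> = (2 ^ k) ^ i * E ^ i" by (simp add: power_mult_distrib)
      also have "\<dots> \<le> (2 ^ k) ^ i * E ^ K"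
        using E1 that by (intro mult_left_mono power_increasing) auto
      finally have "?c * ?M ^ i \<le> ?c * ((2 ^ k) ^ i * E ^ K)"
        using \<Lambda> B(1) by (intro mult_left_mono) auto
      also have "\<dots> = (2 ^ k) ^ i * ((\<Lambda> - 1) / \<Lambda>)" by (simp add: \<Lambda>_def)
      also have "\<dots> \<le> (2 ^ k) ^ i * 1" using \<Lambda> by (intro mult_left_mono) auto
      finally show ?thesis by simp
    qed
    ultimately show "\<exists>c M. deriv_bounded K (\<lambda>x. c) M (\<lambda>x. complex_of_real (\<psi> (x - lattice_point l) *
           (lattice_sum \<psi> (Suc k) A x - lattice_sum \<psi> k A' x) * lattice_sum \<psi> (k + s) A'' x / \<Lambda>)) \<and>
         (\<forall>i\<le>K. c * M ^ i \<le> (2 ^ k) ^ i)"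
      by (intro exI[of _ ?c] exI[of _ ?M]) simp
  qed (rule \<Lambda>)
qed

text \<open>
  The telescoping decomposition. Let \<open>T k\<close> be the smooth approximation of the characteristic function
  of \<open>W\<close> at scale \<open>2\<^bsup>-k\<^esup>\<close>, with \<open>T 0 = 0\<close>. The increments \<open>T (k + 1) - T k\<close>, cut off by \<open>\<psi>\<close> and
  split by the resolution of unity into blocks, are multiples \<open>\<Lambda>\<close> of atoms. Two approximations differ
  only where one of them differs from the characteristic function, so for \<open>k \<ge> 1\<close> all atoms sit in the
  boundary layer of scale \<open>2\<^bsup>-k\<^esup>\<close>. At level 0 all cells near the support of the cut-off may
  occur, but there are only boundedly many of them.
\<close>

lemma atomic_approximation:
  assumes "1 < d"
  obtains \<Lambda> R where "0 < \<Lambda>"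
    "\<And>W l. bounded W \<Longrightarrow> \<exists>a M. (\<forall>k m. is_atom d K k m (a k m)) \<and>
        (\<forall>k\<ge>1. M k \<subseteq> layer_cells W l R k) \<and>
        M 0 \<subseteq> {m. norm (lattice_point m - lattice_point l) \<le> R} \<and>
        (\<forall>N\<ge>1. \<forall>x. cmod (complex_of_real (\<psi> (x - lattice_point l)) * indicator W x -
            (\<Sum>k<N. \<Sum>\<^sub>\<infinity>m. (if m \<in> M k then complex_of_real \<Lambda> else 0) * a k m x)) \<le>
          indicator {x \<in> inner_layer W (2 * sqrt (real CARD('n)) / 2 ^ N).
            norm (x - lattice_point l) \<le> sqrt (real CARD('n))} x)"
proof -
  let ?n = "sqrt (real CARD('n))"
  obtain s where "?n / (d - 1) < 2 ^ s"
    using real_arch_pow[of 2 "?n / (d - 1)"] by auto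
  \<comment> \<open>Fine enough that the block sums are supported in the cubes of atoms, however close \<open>d\<close> is to 1.\<close>
  then have s: "1 + ?n / 2 ^ s \<le> d" using assms by (simp add: field_simps)
  obtain \<Lambda> where \<Lambda>: "0 < \<Lambda>"
    "\<And>k l A A' A''. finite A \<Longrightarrow> finite A' \<Longrightarrow> finite A'' \<Longrightarrow>
       \<exists>c M. deriv_bounded K (\<lambda>x. c) M (\<lambda>x. complex_of_real (\<psi> (x - lattice_point l) *
           (lattice_sum \<psi> (Suc k) A x - lattice_sum \<psi> k A' x) * lattice_sum \<psi> (k + s) A'' x / \<Lambda>)) \<and>
         (\<forall>i\<le>K. c * M ^ i \<le> (2 ^ k) ^ i)"
    using localised_difference_deriv_bounded[of K s] by blast
  show thesis
  proof (rule that[of \<Lambda> "?n * d + ?n"], rule \<Lambda>)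
    fix W :: "(real ^ 'n) set" and l :: "int ^ 'n"
    assume W: "bounded W"
    define I where "I k = (if k = 0 then {} else inner_cells W k)" for k
    define T where "T k = lattice_sum \<psi> k (I k)" for k
    define D where "D k x = \<psi> (x - lattice_point l) * (T (Suc k) x - T k x)" for k x
    define \<Phi> where "\<Phi> k m = lattice_sum \<psi> (k + s) (block s m)" for k m
    define a where "a k m x = complex_of_real (D k x * \<Phi> k m x / \<Lambda>)" for k m x
    define M where "M k = {m. \<exists>x. D k x * \<Phi> k m x \<noteq> 0}" for k
    have finI: "finite (I k)" for k by (simp add: I_def finite_inner_cells W)
    have \<Phi>: "\<bar>2 ^ k * x $ i - lattice_point m $ i\<bar> \<le> d" if "\<Phi> k m x \<noteq> 0" for k m x i
      using block_sum_support[OF _ s] that by (simp add: \<Phi>_def)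
    have D: "norm (x - lattice_point l) \<le> ?n" "k \<ge> 1 \<Longrightarrow> x \<in> inner_layer W (2 * ?n / 2 ^ k)"
      if "D k x \<noteq> 0" for k x
    proof -
      show "norm (x - lattice_point l) \<le> ?n" using that psi_support by (simp add: D_def)
      assume k: "k \<ge> 1"
      show "x \<in> inner_layer W (2 * ?n / 2 ^ k)"
      proof (rule ccontr)
        assume x: "x \<notin> inner_layer W (2 * ?n / 2 ^ k)"
        then have x': "x \<notin> inner_layer W (2 * ?n / 2 ^ Suc k)"
          using inner_layer_mono[of "2 * ?n / 2 ^ Suc k" "2 * ?n / 2 ^ k" W] by (auto simp: field_simps)
        have "T (Suc k) x = T k x"
          using k lattice_sum_inner_cells[OF W x] lattice_sum_inner_cells[OF W x']
          by (simp add: T_def I_def)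
        with that show False by (simp add: D_def)
      qed
    qed
    have dist_le: "norm (2 ^ k *\<^sub>R x - lattice_point m) \<le> ?n * d" if "\<Phi> k m x \<noteq> 0" for k m x
      using \<Phi>[OF that] by (intro norm_le_sqrt_card) simp
    have atom: "is_atom d K k m (a k m)" for k m
    proof -
      obtain c M' where c: "deriv_bounded K (\<lambda>x. c) M' (a k m)" "\<And>i. i \<le> K \<Longrightarrow> c * M' ^ i \<le> (2 ^ k) ^ i"
        using \<Lambda>(2)[OF finI[of "Suc k"] finI[of k] finite_block[of s m], where k = k and l = l]
        unfolding a_def[abs_def] D_def T_def \<Phi>_def by blast
      show ?thesis
      proof (rule is_atomI[OF c(1) _ c(2)])
        fix x assume "a k m x \<noteq> 0"
        then have "\<Phi> k m x \<noteq> 0" by (simp add: a_def)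
        from \<Phi>[OF this] show "x \<in> dcube d k m"
          by (simp add: dcube_def dyadic_powr abs_mult abs_le_iff field_simps)
      qed
    qed
    have level_sum: "(\<Sum>\<^sub>\<infinity>m. (if m \<in> M k then complex_of_real \<Lambda> else 0) * a k m x) = complex_of_real (D k x)"
      for k x
    proof -
      have "(if m \<in> M k then complex_of_real \<Lambda> else 0) * a k m x =
          complex_of_real (D k x) * complex_of_real (\<Phi> k m x)" for m
        using \<Lambda>(1) by (auto simp: M_def a_def)
      moreover have "((\<lambda>m. complex_of_real (D k x) * complex_of_real (\<Phi> k m x)) has_sum
          complex_of_real (D k x) * complex_of_real 1) UNIV"
        unfolding \<Phi>_def by (intro has_sum_cmult_right has_sum_of_real has_sum_blocks)
      ultimately show ?thesis by (simp add: infsumI)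
    qed
    have approx: "cmod (complex_of_real (\<psi> (x - lattice_point l)) * indicator W x -
            (\<Sum>k<N. \<Sum>\<^sub>\<infinity>m. (if m \<in> M k then complex_of_real \<Lambda> else 0) * a k m x)) \<le>
          indicator {x \<in> inner_layer W (2 * ?n / 2 ^ N). norm (x - lattice_point l) \<le> ?n} x"
      (is "cmod ?e \<le> indicator ?L x") if N: "N \<ge> 1" for N x
    proof -
      have "(\<Sum>k<N. D k x) = \<psi> (x - lattice_point l) * (\<Sum>k<N. T (Suc k) x - T k x)"
        by (simp add: D_def sum_distrib_left)
      also have "\<dots> = \<psi> (x - lattice_point l) * lattice_sum \<psi> N (inner_cells W N) x"
        unfolding sum_lessThan_telescope[of "\<lambda>k. T k x"] using N by (simp add: T_def I_def lattice_sum_def)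
      finally have e: "?e = complex_of_real (\<psi> (x - lattice_point l) *
          (indicator W x - lattice_sum \<psi> N (inner_cells W N) x))"
        by (simp add: level_sum indicator_def right_diff_distrib flip: of_real_sum)
      show ?thesis
      proof (cases "x \<in> ?L")
        case True
        have "\<bar>indicator W x - lattice_sum \<psi> N (inner_cells W N) x\<bar> \<le> 1"
          using lattice_sum_bounds[OF finite_inner_cells[OF W, of N], of N x] by (simp add: indicator_def)
        then have "\<bar>\<psi> (x - lattice_point l)\<bar> * \<bar>indicator W x - lattice_sum \<psi> N (inner_cells W N) x\<bar> \<le> 1 * 1"
          using psi_nonneg psi_le_1 by (intro mult_mono) auto
        with True show ?thesis unfolding e by (simp add: abs_mult del: of_real_mult of_real_diff)
      next
        case False
        then have "\<psi> (x - lattice_point l) = 0 \<or> x \<notin> inner_layer W (2 * ?n / 2 ^ N)"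
          using psi_support by auto
        then have "?e = 0" unfolding e using lattice_sum_inner_cells[OF W] by auto
        then show ?thesis by simp
      qed
    qed
    have "M k \<subseteq> layer_cells W l (?n * d + ?n) k" if "k \<ge> 1" for k
    proof
      fix m assume "m \<in> M k"
      then obtain x where x: "D k x \<noteq> 0" "\<Phi> k m x \<noteq> 0" by (auto simp: M_def)
      have "norm (2 ^ k *\<^sub>R x - lattice_point m) \<le> ?n * d + ?n"
        using dist_le[OF x(2)] by (simp add: add_increasing2)
      then show "m \<in> layer_cells W l (?n * d + ?n) k"
        using D[OF x(1)] that unfolding layer_cells_def by blast
    qed
    moreover have "M 0 \<subseteq> {m. norm (lattice_point m - lattice_point l) \<le> ?n * d + ?n}"
    proof
      fix m assume "m \<in> M 0"
      then obtain x where x: "D 0 x \<noteq> 0" "\<Phi> 0 m x \<noteq> 0" by (auto simp: M_def)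
      show "m \<in> {m. norm (lattice_point m - lattice_point l) \<le> ?n * d + ?n}"
        using dist_le[OF x(2)] D(1)[OF x(1)]
          norm_triangle_ineq4[of "x - lattice_point l" "x - lattice_point m"] by simp
    qed
    ultimately show "\<exists>a M. (\<forall>k m. is_atom d K k m (a k m)) \<and>
        (\<forall>k\<ge>1. M k \<subseteq> layer_cells W l (?n * d + ?n) k) \<and>
        M 0 \<subseteq> {m. norm (lattice_point m - lattice_point l) \<le> ?n * d + ?n} \<and>
        (\<forall>N\<ge>1. \<forall>x. cmod (complex_of_real (\<psi> (x - lattice_point l)) * indicator W x -
            (\<Sum>k<N. \<Sum>\<^sub>\<infinity>m. (if m \<in> M k then complex_of_real \<Lambda> else 0) * a k m x)) \<le>
          indicator {x \<in> inner_layer W (2 * ?n / 2 ^ N). norm (x - lattice_point l) \<le> ?n} x)"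
      using atom approx by (intro exI[of _ a] exI[of _ M] conjI allI impI) blast+
  qed
qed

end

section \<open>Characteristic functions in self-similar spaces\<close>

lemma layer_cells_subset_boundary_cells:
  fixes \<Omega> :: "(real ^ 'n) set"
  assumes "R \<le> R'"
  shows "layer_cells {x. (1 / 2 ^ j) *\<^sub>R x \<in> \<Omega>} l R k \<subseteq>
    boundary_cells (frontier \<Omega>) (3 * sqrt (real CARD('n))) (R' + 2 * sqrt (real CARD('n))) j k
      (lattice_point l)"
proof
  let ?n = "sqrt (real CARD('n))"
  fix m assume "m \<in> layer_cells {x. (1 / 2 ^ j) *\<^sub>R x \<in> \<Omega>} l R k"
  then obtain x where x: "x \<in> inner_layer {x. (1 / 2 ^ j) *\<^sub>R x \<in> \<Omega>} (2 * ?n / 2 ^ k)"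
    "norm (x - lattice_point l) \<le> ?n" "norm (2 ^ k *\<^sub>R x - lattice_point m) \<le> R"
    unfolding layer_cells_def by blast
  obtain \<gamma> where \<gamma>: "\<gamma> \<in> frontier \<Omega>" "norm (2 ^ j *\<^sub>R \<gamma> - x) \<le> 2 * ?n / 2 ^ k"
    using frontier_near_inner_layer[OF x(1)] by blast
  have "2 * ?n / 2 ^ k \<le> 2 * ?n / 1" by (intro divide_left_mono) auto
  then have 1: "norm (2 ^ j *\<^sub>R \<gamma> - lattice_point l) \<le> 3 * ?n"
    using norm_triangle_ineq[of "2 ^ j *\<^sub>R \<gamma> - x" "x - lattice_point l"] x(2) \<gamma>(2) by simp
  have "norm (2 ^ k *\<^sub>R (2 ^ j *\<^sub>R \<gamma> - x)) = 2 ^ k * norm (2 ^ j *\<^sub>R \<gamma> - x)" by simp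
  also have "\<dots> \<le> 2 ^ k * (2 * ?n / 2 ^ k)" by (intro mult_left_mono \<gamma>) simp
  finally have "norm (2 ^ k *\<^sub>R (2 ^ j *\<^sub>R \<gamma> - x)) \<le> 2 * ?n" by simp
  then have "norm (2 ^ k *\<^sub>R (2 ^ j *\<^sub>R \<gamma> - x) + (2 ^ k *\<^sub>R x - lattice_point m)) \<le> R' + 2 * ?n"
    using norm_triangle_ineq[of "2 ^ k *\<^sub>R (2 ^ j *\<^sub>R \<gamma> - x)" "2 ^ k *\<^sub>R x - lattice_point m"]
      x(3) assms by linarith
  also have "2 ^ k *\<^sub>R (2 ^ j *\<^sub>R \<gamma> - x) + (2 ^ k *\<^sub>R x - lattice_point m) =
      2 ^ (j + k) *\<^sub>R \<gamma> - lattice_point m"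
    by (simp add: power_add scaleR_diff_right mult.commute)
  finally have "norm (2 ^ (j + k) *\<^sub>R \<gamma> - lattice_point m) \<le> R' + 2 * ?n" .
  with 1 \<gamma>(1) show "m \<in> boundary_cells (frontier \<Omega>) (3 * ?n) (R' + 2 * ?n) j k (lattice_point l)"
    unfolding boundary_cells_def by blast
qed

text \<open>
  The error of the approximation at scale \<open>2\<^bsup>-k\<^esup>\<close> is supported in the boundary layer, which is covered by
  the cells that are counted by the \<open>h\<close>-set property; this is what turns the count into a volume bound.
\<close>

lemma inner_layer_subset_dcubes:
  fixes W :: "(real ^ 'n) set"
  shows "{x \<in> inner_layer W (2 * sqrt (real CARD('n)) / 2 ^ k).
      norm (x - lattice_point l) \<le> sqrt (real CARD('n))} \<subseteq>
    (\<Union>m\<in>layer_cells W l (sqrt (real CARD('n))) k. dcube 1 k m)"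
proof
  fix x assume x: "x \<in> {x \<in> inner_layer W (2 * sqrt (real CARD('n)) / 2 ^ k).
      norm (x - lattice_point l) \<le> sqrt (real CARD('n))}"
  obtain m :: "int ^ 'n" where m: "\<And>i. \<bar>(2 ^ k *\<^sub>R x) $ i - lattice_point m $ i\<bar> \<le> 1"
    "norm (2 ^ k *\<^sub>R x - lattice_point m) \<le> sqrt (real CARD('n))"
    using lattice_point_near by blast
  have "m \<in> layer_cells W l (sqrt (real CARD('n))) k"
    using x m(2) unfolding layer_cells_def by blast
  moreover have "x \<in> dcube 1 k m"
    using m(1) by (simp add: dcube_def dyadic_powr abs_le_iff field_simps)
  ultimately show "x \<in> (\<Union>m\<in>layer_cells W l (sqrt (real CARD('n))) k. dcube 1 k m)" by blast
qed

lemma besov_qnorm_le: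
  assumes "f \<in> Lp_space p" "atomic_representation d K s p q f lam a"
  shows "besov_qnorm d K s p q f \<le> b_qnorm s p q lam"
  using assms unfolding besov_qnorm_def besov_space_def by (auto intro!: Inf_lower)

lemma Lp_spaceI_indicator:
  assumes "0 < p" "F \<in> sets lebesgue" "emeasure lebesgue F < \<infinity>"
    "\<And>x. cmod (f x) \<le> indicator F x" "f \<in> borel_measurable lebesgue"
  shows "f \<in> Lp_space (ennreal p)"
  using Lp_qnorm_le_indicator[OF assms(1,2,4)] epowr_less_top[OF assms(3), of "1 / p"] assms(5)
  by (simp add: Lp_space_def)

theorem theorem5p7:
  fixes \<Omega> :: "(real ^ 'n) set" and h :: "real \<Rightarrow> real"
    and \<sigma> p d :: real and q :: ennreal and K :: nat and \<psi> :: "real ^ 'n \<Rightarrow> real"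
  assumes "d > 1" and "int K \<ge> 1 + \<lfloor>\<sigma>\<rfloor>" and "resolution_of_unity \<psi>"
    and "open \<Omega>" and "connected \<Omega>" and "\<Omega> \<noteq> {}" and "bounded \<Omega>"
    and "\<sigma> > 0" and "p > 0" and "q > 0"
    and "h_set h (frontier \<Omega>)"
    and "h_condition CARD('n) h \<sigma> p q"
  shows "(indicator \<Omega> :: real ^ 'n \<Rightarrow> complex) \<in> besov_selfs_space \<psi> d K \<sigma> (ennreal p) q"
proof -
  interpret smooth_resolution \<psi> by standard fact
  let ?n = "sqrt (real CARD('n))"
  have hpos: "0 < h (2 powr (- real j))" for j
    using \<open>h_set h (frontier \<Omega>)\<close> unfolding h_set_def dyadic_powr by simp
  define H where "H j k = h (2 powr (- real j)) / h (2 powr (- real (j + k)))" for j k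
  have Hpos: "0 < H j k" for j k unfolding H_def by (intro divide_pos_pos hpos)
  have ratio: "h_ratio CARD('n) h j k = H j k * 2 powr (- real (k * CARD('n)))" for j k
    by (simp add: h_ratio_def H_def)
  have ratio_nonneg: "0 \<le> h_ratio CARD('n) h j k" for j k
    using Hpos[of j k] by (simp add: ratio)

  obtain \<Lambda> R where \<Lambda>: "0 < \<Lambda>" and approx:
    "\<And>W l. bounded W \<Longrightarrow> \<exists>a M. (\<forall>k m. is_atom d K k m (a k m)) \<and>
        (\<forall>k\<ge>1. M k \<subseteq> layer_cells W l R k) \<and>
        M 0 \<subseteq> {m. norm (lattice_point m - lattice_point l) \<le> R} \<and>
        (\<forall>N\<ge>1. \<forall>x. cmod (complex_of_real (\<psi> (x - lattice_point l)) * indicator W x -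
            (\<Sum>k<N. \<Sum>\<^sub>\<infinity>m. (if m \<in> M k then complex_of_real \<Lambda> else 0) * a k m x)) \<le>
          indicator {x \<in> inner_layer W (2 * ?n / 2 ^ N). norm (x - lattice_point l) \<le> ?n} x)"
    using atomic_approximation[OF \<open>d > 1\<close>, of K] by blast
  define R' where "R' = max R ?n"
  obtain C where C: "0 < C" "\<And>j k b. 1 \<le> k \<Longrightarrow>
       finite (boundary_cells (frontier \<Omega>) (3 * ?n) (R' + 2 * ?n) j k b) \<and>
       real (card (boundary_cells (frontier \<Omega>) (3 * ?n) (R' + 2 * ?n) j k b)) \<le> C * H j k"
    using card_boundary_cells_le[OF \<open>h_set h (frontier \<Omega>)\<close>, of "3 * ?n" "R' + 2 * ?n"]
    unfolding H_def by blast
  obtain N0 :: nat where N0: "\<And>y :: real ^ 'n. card {m :: int ^ 'n. norm (lattice_point m - y) \<le> R} \<le> N0"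
    using card_lattice_cball_bounded[of R] by blast
  \<comment> \<open>At level 0 the ratio of the values of h is 1, so a fixed number of cells obeys the same bound.\<close>
  define C' where "C' = max C (real N0)"
  obtain B where B: "0 \<le> B"
    "\<And>j k. 2 powr (real k * \<sigma>) * h_ratio CARD('n) h j k powr (1 / p) \<le> B"
    using h_condition_bounded[OF \<open>h_condition _ _ _ _ _\<close> \<open>p > 0\<close> \<open>q > 0\<close> ratio_nonneg] by blast
  have "0 \<le> \<Lambda> * C' powr (1 / p)" using \<Lambda> by simp
  then obtain S where S: "S < \<infinity>"
    "\<And>j u. (\<And>k. u k \<le> ennreal ((\<Lambda> * C' powr (1 / p)) *
         (2 powr (real k * \<sigma>) * h_ratio CARD('n) h j k powr (1 / p))))
       \<Longrightarrow> seq_qnorm q u \<le> S"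
    using h_condition_seq_qnorm[OF \<open>h_condition _ _ _ _ _\<close> \<open>p > 0\<close> \<open>q > 0\<close> _ ratio_nonneg] by blast

  have bound: "besov_qnorm d K \<sigma> (ennreal p) q
      (\<lambda>x. complex_of_real (\<psi> (x - lattice_point l)) * indicator \<Omega> (2 powr (- real j) *\<^sub>R x)) \<le> S"
    for j and l :: "int ^ 'n"
  proof -
    define W where "W = {x. (1 / 2 ^ j) *\<^sub>R x \<in> \<Omega>}"
    define f where "f x = complex_of_real (\<psi> (x - lattice_point l)) * indicator W x" for x
    have f_eq: "(\<lambda>x. complex_of_real (\<psi> (x - lattice_point l)) * indicator \<Omega> (2 powr (- real j) *\<^sub>R x)) = f"
      by (simp add: fun_eq_iff f_def W_def dyadic_powr indicator_def)
    have "W \<subseteq> (\<lambda>y. 2 ^ j *\<^sub>R y) ` \<Omega>"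
    proof
      fix x assume "x \<in> W"
      then show "x \<in> (\<lambda>y. 2 ^ j *\<^sub>R y) ` \<Omega>"
        by (intro image_eqI[of _ _ "(1 / 2 ^ j) *\<^sub>R x"]) (auto simp: W_def)
    qed
    then have W: "bounded W"
      using bounded_scaling[OF \<open>bounded \<Omega>\<close>] bounded_subset by blast
    have "open ((\<lambda>x. (1 / 2 ^ j) *\<^sub>R x) -` \<Omega>)"
      by (intro open_vimage \<open>open \<Omega>\<close> continuous_intros)
    then have W_open: "open W" by (simp add: W_def vimage_def)

    obtain a M where atoms: "\<And>k m. is_atom d K k m (a k m)"
      and M: "\<And>k. k \<ge> 1 \<Longrightarrow> M k \<subseteq> layer_cells W l R k"
      and M0: "M 0 \<subseteq> {m. norm (lattice_point m - lattice_point l) \<le> R}"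
      and err: "\<And>N x. N \<ge> 1 \<Longrightarrow> cmod (f x -
            (\<Sum>k<N. \<Sum>\<^sub>\<infinity>m. (if m \<in> M k then complex_of_real \<Lambda> else 0) * a k m x)) \<le>
          indicator {x \<in> inner_layer W (2 * ?n / 2 ^ N). norm (x - lattice_point l) \<le> ?n} x"
      using approx[OF W, of l] unfolding f_def by blast
    define lam where "lam k m = (if m \<in> M k then complex_of_real \<Lambda> else 0)" for k m

    have cells: "finite (layer_cells W l r k) \<and> real (card (layer_cells W l r k)) \<le> C * H j k"
      if "k \<ge> 1" "r \<le> R'" for k r
    proof -
      have sub: "layer_cells W l r k \<subseteq>
          boundary_cells (frontier \<Omega>) (3 * ?n) (R' + 2 * ?n) j k (lattice_point l)"
        unfolding W_def by (rule layer_cells_subset_boundary_cells) (rule that)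
      from C(2)[OF that(1), of j "lattice_point l"] have
        fin: "finite (boundary_cells (frontier \<Omega>) (3 * ?n) (R' + 2 * ?n) j k (lattice_point l))" and
        le: "real (card (boundary_cells (frontier \<Omega>) (3 * ?n) (R' + 2 * ?n) j k (lattice_point l))) \<le> C * H j k"
        by auto
      show ?thesis
        using finite_subset[OF sub fin] card_mono[OF fin sub] le by linarith
    qed
    have M_card: "finite (M k) \<and> real (card (M k)) \<le> C' * H j k" for k
    proof (cases "k = 0")
      case True
      have fin: "finite {m. norm (lattice_point m - lattice_point l) \<le> R}" by (rule finite_lattice_cball)
      have "card (M 0) \<le> N0" using card_mono[OF fin M0] N0[of "lattice_point l"] by linarith
      moreover have "H j 0 = 1" using hpos[of j] unfolding H_def by simp
      ultimately show ?thesis using finite_subset[OF M0 fin] True by (simp add: C'_def)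
    next
      case False
      then have k: "k \<ge> 1" by simp
      have c: "finite (layer_cells W l R k)" "real (card (layer_cells W l R k)) \<le> C * H j k"
        using cells[OF k, of R] by (auto simp: R'_def)
      have "real (card (M k)) \<le> C * H j k" using card_mono[OF c(1) M[OF k]] c(2) by linarith
      also have "\<dots> \<le> C' * H j k" using Hpos[of j k] by (intro mult_right_mono) (auto simp: C'_def)
      finally show ?thesis using finite_subset[OF M[OF k] c(1)] by simp
    qed

    have inv_p: "enn2real (1 / ennreal p) = 1 / p"
      using \<open>p > 0\<close> by (simp add: divide_ennreal_def inverse_ennreal inverse_eq_divide)
    \<comment> \<open>The weight \<open>2\<^bsup>-kn/p\<^esup>\<close> in the sequence norm is the volume factor of the ratio.\<close>
    have split: "h_ratio CARD('n) h j k powr (1 / p) =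
        H j k powr (1 / p) * 2 powr (- (real k * (real CARD('n) / p)))" for k
      using Hpos[of j k] by (simp add: ratio powr_mult powr_powr)
    have norm_le: "b_qnorm \<sigma> (ennreal p) q lam \<le> S"
      unfolding b_qnorm_def
    proof (rule S(2)[of _ j])
      fix k
      have "real (card (M k)) powr (1 / p) \<le> (C' * H j k) powr (1 / p)"
        using M_card \<open>p > 0\<close> by (intro powr_mono2) auto
      also have "\<dots> = C' powr (1 / p) * H j k powr (1 / p)"
        by (rule powr_mult)
      finally have card_powr: "real (card (M k)) powr (1 / p) \<le> C' powr (1 / p) * H j k powr (1 / p)" .
      have "ennreal (2 powr (real k * (\<sigma> - real CARD('n) * enn2real (1 / ennreal p)))) *
            seq_qnorm (ennreal p) (\<lambda>m. ennreal (cmod (lam k m)))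
          = ennreal (2 powr (real k * (\<sigma> - real CARD('n) / p)) * (\<Lambda> * real (card (M k)) powr (1 / p)))"
        using M_card[of k] \<Lambda> \<open>p > 0\<close> unfolding lam_def inv_p
        by (subst seq_qnorm_finite_const) (auto simp: ennreal_mult)
      also have "\<dots> \<le> ennreal (2 powr (real k * (\<sigma> - real CARD('n) / p)) *
          (\<Lambda> * (C' powr (1 / p) * H j k powr (1 / p))))"
        using \<Lambda> card_powr by (intro ennreal_leI mult_left_mono) auto
      also have "2 powr (real k * (\<sigma> - real CARD('n) / p)) =
          2 powr (real k * \<sigma>) * 2 powr (- (real k * (real CARD('n) / p)))"
        by (simp add: right_diff_distrib powr_diff powr_minus divide_inverse)
      finally show "ennreal (2 powr (real k * (\<sigma> - real CARD('n) * enn2real (1 / ennreal p)))) *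
            seq_qnorm (ennreal p) (\<lambda>m. ennreal (cmod (lam k m))) \<le>
          ennreal (\<Lambda> * C' powr (1 / p) * (2 powr (real k * \<sigma>) * h_ratio CARD('n) h j k powr (1 / p)))"
        unfolding split by (simp only: mult_ac)
    qed

    let ?e = "\<lambda>N x. f x - (\<Sum>k<N. \<Sum>\<^sub>\<infinity>m. lam k m * a k m x)"
    \<comment> \<open>The layer at level N is covered by at most \<open>C * H j N\<close> cubes of side \<open>2 * 2\<^bsup>-N\<^esup>\<close>.\<close>
    define c where "c = (C * 2 ^ CARD('n)) powr (1 / p) * B"
    have Lp_err: "Lp_qnorm (ennreal p) (?e N) \<le> ennreal (c * 2 powr (- (real N * \<sigma>)))" if N: "N \<ge> 1" for N
    proof -
      define F where "F = (\<Union>m\<in>layer_cells W l ?n N. dcube 1 N m)"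
      have fin: "finite (layer_cells W l ?n N)" and
        card: "real (card (layer_cells W l ?n N)) \<le> C * H j N"
        using cells[OF N, of ?n] by (auto simp: R'_def)
      have F: "F \<in> sets lebesgue" unfolding F_def using fin by (intro sets.finite_UN dcube_lebesgue)
      have "cmod (?e N x) \<le> indicator F x" for x
      proof -
        have "(indicator {x \<in> inner_layer W (2 * ?n / 2 ^ N). norm (x - lattice_point l) \<le> ?n} x :: real)
            \<le> indicator F x"
          unfolding F_def using inner_layer_subset_dcubes[of W N l]
          by (intro indicator_leI) blast
        with err[OF N, of x] show ?thesis unfolding lam_def by (rule order_trans)
      qed
      then have "Lp_qnorm (ennreal p) (?e N) \<le> epowr (emeasure lebesgue F) (1 / p)"
        by (rule Lp_qnorm_le_indicator[OF \<open>p > 0\<close> F])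
      also have "emeasure lebesgue F \<le> ennreal (C * 2 ^ CARD('n) * h_ratio CARD('n) h j N)"
      proof -
        have "emeasure lebesgue F \<le> (\<Sum>m\<in>layer_cells W l ?n N. emeasure lebesgue (dcube 1 N m))"
          unfolding F_def using fin by (intro emeasure_subadditive_finite) (auto intro: dcube_lebesgue)
        also have "\<dots> = ennreal (real (card (layer_cells W l ?n N)) * (2 / 2 ^ N) ^ CARD('n))"
          by (simp add: emeasure_dcube ennreal_mult ennreal_of_nat_eq_real_of_nat)
        also have "\<dots> \<le> ennreal (C * H j N * (2 / 2 ^ N) ^ CARD('n))"
          using card by (intro ennreal_leI mult_right_mono) auto
        also have "C * H j N * (2 / 2 ^ N) ^ CARD('n) = C * 2 ^ CARD('n) * h_ratio CARD('n) h j N"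
          unfolding ratio dyadic_powr by (simp add: power_divide power_mult)
        finally show ?thesis .
      qed
      then have "epowr (emeasure lebesgue F) (1 / p) \<le>
          epowr (ennreal (C * 2 ^ CARD('n) * h_ratio CARD('n) h j N)) (1 / p)"
        using \<open>p > 0\<close> by (intro epowr_mono) auto
      also have "\<dots> = ennreal ((C * 2 ^ CARD('n) * h_ratio CARD('n) h j N) powr (1 / p))"
        using C(1) ratio_nonneg[of j N] by (intro epowr_ennreal) auto
      also have "(C * 2 ^ CARD('n) * h_ratio CARD('n) h j N) powr (1 / p) =
          (C * 2 ^ CARD('n)) powr (1 / p) * h_ratio CARD('n) h j N powr (1 / p)"
        by (rule powr_mult)
      also have "\<dots> \<le> ennreal (c * 2 powr (- (real N * \<sigma>)))"
      proof (rule ennreal_leI)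
        have "h_ratio CARD('n) h j N powr (1 / p) \<le> B * 2 powr (- (real N * \<sigma>))"
          using B(2)[of N j] by (simp add: powr_minus field_simps)
        then have "(C * 2 ^ CARD('n)) powr (1 / p) * h_ratio CARD('n) h j N powr (1 / p) \<le>
            (C * 2 ^ CARD('n)) powr (1 / p) * (B * 2 powr (- (real N * \<sigma>)))"
          by (intro mult_left_mono) auto
        then show "(C * 2 ^ CARD('n)) powr (1 / p) * h_ratio CARD('n) h j N powr (1 / p) \<le>
            c * 2 powr (- (real N * \<sigma>))"
          by (simp add: c_def mult.assoc)
      qed
      finally show ?thesis .
    qed
    have "2 powr (- (real N * \<sigma>)) = (2 powr (- \<sigma>)) ^ N" for N
      by (simp add: powr_powr mult.commute flip: powr_realpow)
    moreover have "(\<lambda>N. (2 powr (- \<sigma>)) ^ N) \<longlonglongrightarrow> 0"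
      using powr_less_one[of 2 "- \<sigma>"] \<open>\<sigma> > 0\<close> by (intro LIMSEQ_realpow_zero) auto
    ultimately have "(\<lambda>N. c * 2 powr (- (real N * \<sigma>))) \<longlonglongrightarrow> c * 0"
      by (intro tendsto_mult_left) simp
    then have "(\<lambda>N. ennreal (c * 2 powr (- (real N * \<sigma>)))) \<longlonglongrightarrow> ennreal 0"
      by (intro tendsto_ennrealI) simp
    then have up: "(\<lambda>N. ennreal (c * 2 powr (- (real N * \<sigma>)))) \<longlonglongrightarrow> 0"
      by (simp only: ennreal_0)
    have lim: "(\<lambda>N. Lp_qnorm (ennreal p) (?e N)) \<longlonglongrightarrow> 0"
    proof (rule tendsto_sandwich[OF _ _ tendsto_const up])
      show "\<forall>\<^sub>F N in sequentially. Lp_qnorm (ennreal p) (?e N) \<le> ennreal (c * 2 powr (- (real N * \<sigma>)))"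
        by (rule eventually_sequentiallyI[of 1]) (rule Lp_err)
    qed simp

    have f_Lp: "f \<in> Lp_space (ennreal p)"
    proof (rule Lp_spaceI_indicator[OF \<open>p > 0\<close>])
      show "cball (lattice_point l) ?n \<in> sets lebesgue" by simp
      show "emeasure lebesgue (cball (lattice_point l :: real ^ 'n) ?n) < \<infinity>"
        using emeasure_lborel_cball_finite[of "lattice_point l" ?n] by simp
      show "cmod (f x) \<le> indicator (cball (lattice_point l) ?n) x" for x
        using psi_nonneg[of "x - lattice_point l"] psi_le_1[of "x - lattice_point l"]
          psi_support[of "x - lattice_point l"]
        by (auto simp: f_def norm_mult indicator_def dist_norm norm_minus_commute)
      have "Ck 0 \<psi>" using resolution unfolding resolution_of_unity_def by blast
      then have "continuous_on UNIV (\<lambda>x. complex_of_real (\<psi> (x - lattice_point l)))"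
        by (auto intro!: continuous_intros continuous_on_compose2[of UNIV \<psi>])
      then have "(\<lambda>x. complex_of_real (\<psi> (x - lattice_point l))) \<in> borel_measurable borel"
        by (rule borel_measurable_continuous_onI)
      moreover have "W \<in> sets borel" using W_open by simp
      ultimately have "f \<in> borel_measurable borel"
        unfolding f_def by measurable
      then show "f \<in> borel_measurable lebesgue"
        by (intro measurable_completion) simp
    qed
    have "atomic_representation d K \<sigma> (ennreal p) q f lam a"
      unfolding atomic_representation_def
      using atoms le_less_trans[OF norm_le S(1)] lim by blast
    from besov_qnorm_le[OF f_Lp this] norm_le show ?thesis
      unfolding f_eq by (rule order_trans)
  qed

  have "(indicator \<Omega> :: real ^ 'n \<Rightarrow> complex) \<in> Lp_loc_space (min 1 (ennreal p))"
    unfolding Lp_loc_space_def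
  proof (intro CollectI allI impI)
    fix Q :: "(real ^ 'n) set" assume Q: "compact Q"
    have "min 1 (ennreal p) = ennreal (min 1 p)"
      using \<open>p > 0\<close> by (simp add: min_def ennreal_le_iff2 flip: ennreal_1)
    moreover have "(\<lambda>x. indicator Q x * indicator \<Omega> x :: complex) \<in> Lp_space (ennreal (min 1 p))"
    proof (rule Lp_spaceI_indicator)
      show "Q \<in> sets lebesgue" using Q by (simp add: borel_compact)
      show "emeasure lebesgue Q < \<infinity>" 
        using emeasure_compact_finite[OF Q] Q by (simp add: borel_compact)
      have "Q \<in> sets borel" "\<Omega> \<in> sets borel" using Q \<open>open \<Omega>\<close> by (auto simp: borel_compact)
      then have "(\<lambda>x. indicator Q x * indicator \<Omega> x :: complex) \<in> borel_measurable borel" by measurable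
      then show "(\<lambda>x. indicator Q x * indicator \<Omega> x :: complex) \<in> borel_measurable lebesgue"
        by (intro measurable_completion) simp
    qed (use \<open>p > 0\<close> in \<open>auto simp: indicator_def\<close>)
    ultimately show "(\<lambda>x. indicator Q x * indicator \<Omega> x :: complex) \<in> Lp_space (min 1 (ennreal p))" by simp
  qed
  moreover have "(SUP j. SUP l. besov_qnorm d K \<sigma> (ennreal p) q
      (\<lambda>x. complex_of_real (\<psi> (x - lattice_point l)) * indicator \<Omega> (2 powr (- real j) *\<^sub>R x))) \<le> S"
    by (intro SUP_least bound)
  ultimately show ?thesis
    using le_less_trans[OF _ S(1)] unfolding besov_selfs_space_def by blast
qed

end
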